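(* There exists a constant $c>0$ such that for every $V>0$, $$c\min\{V,\,V^{3/4}\}\le F^{3D}_\ell(V)\le\frac{1}{c}\min\{V,\,V^{3/4}\}.$$
   Context: For $h:\mathbb{R}^2\to[0,\infty)$ let $\Omega_h:=\{(x,y,z)\in\mathbb{R}^3:0<z<h(x,y)\}$. For $V>0$, $$F^{3D}_\ell(V):=\inf\left\{\int_{\Omega_h}|\nabla u|^2\,dx\,dy\,dz+\int_{\mathbb{R}^2}|\nabla h|\,dx\,dy\right\},$$ where the infimum is over all pairs $(u,h)$ with $h\in BV(\mathbb{R}^2)\cap W^{1,\infty}(\mathbb{R}^2)$, $h\ge0$, $\int_{\mathbb{R}^2}h\,dx\,dy=V$, $u\in H^1(\Omega_h;\mathbb{R}^2)$, and $u(x,y,0)=(x,y)$ (in the sense of traces) for $(x,y)\in\operatorname{supp}h$. *)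

theory Defs
  imports "HOL-Analysis.Analysis"
begin

section \<open>Test functions\<close>

definition supp :: "('a::euclidean_space \<Rightarrow> 'b::real_normed_vector) \<Rightarrow> 'a set" where
  "supp f = closure {x. f x \<noteq> 0}"

definition partial :: "'a::euclidean_space \<Rightarrow> ('a \<Rightarrow> 'b::real_normed_vector) \<Rightarrow> 'a \<Rightarrow> 'b" where
  "partial b f x = frechet_derivative f (at x) b"

definition C1c :: "('a::euclidean_space \<Rightarrow> 'b::real_normed_vector) set" where
  "C1c = {f. (\<forall>x. f differentiable (at x)) \<and>
             (\<forall>b\<in>Basis. continuous_on UNIV (partial b f)) \<and> compact (supp f)}"

definition divergence :: "('a::euclidean_space \<Rightarrow> 'a) \<Rightarrow> 'a \<Rightarrow> real" where
  "divergence f x = (\<Sum>b\<in>Basis. partial b f x \<bullet> b)"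

section \<open>Function spaces\<close>

text \<open>Elements of the spaces below are represented by functions that are Borel measurable on
  the given open set; only their values there matter.
  A gradient is a family \<open>D\<close>, where \<open>D b\<close> is the partial derivative in the basis direction
  \<open>b\<close>. As weak gradients are unique up to null sets, it is harmless to carry them along as a
  separate argument.\<close>

definition locally_integrable ::
    "'a::euclidean_space set \<Rightarrow> ('a \<Rightarrow> 'b::euclidean_space) \<Rightarrow> bool" where
  "locally_integrable U f \<longleftrightarrow> (\<forall>K. compact K \<and> K \<subseteq> U \<longrightarrow> set_integrable lborel K f)"

definition weak_gradient ::
    "'a::euclidean_space set \<Rightarrow> ('a \<Rightarrow> 'b::euclidean_space) \<Rightarrow> ('a \<Rightarrow> 'a \<Rightarrow> 'b) \<Rightarrow> bool" where
  "weak_gradient U f D \<longleftrightarrow> locally_integrable U f \<and>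
     (\<forall>b\<in>Basis. locally_integrable U (D b) \<and>
        (\<forall>\<phi>\<in>C1c. supp \<phi> \<subseteq> U \<longrightarrow>
           (LINT x:U|lborel. partial b \<phi> x *\<^sub>R f x) = - (LINT x:U|lborel. \<phi> x *\<^sub>R D b x)))"

text \<open>Euclidean (for vector-valued functions: Frobenius) norm of the gradient.\<close>

definition grad_norm ::
    "('a::euclidean_space \<Rightarrow> 'a \<Rightarrow> 'b::euclidean_space) \<Rightarrow> 'a \<Rightarrow> real" where
  "grad_norm D x = sqrt (\<Sum>b\<in>Basis. (norm (D b x))\<^sup>2)"

definition L2 :: "'a::euclidean_space set \<Rightarrow> ('a \<Rightarrow> 'b::euclidean_space) set" where
  "L2 U = {f. set_borel_measurable lborel U f \<and> set_integrable lborel U (\<lambda>x. (norm (f x))\<^sup>2)}"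

definition Linf :: "'a::euclidean_space set \<Rightarrow> ('a \<Rightarrow> 'b::euclidean_space) set" where
  "Linf U = {f. set_borel_measurable lborel U f \<and> (\<exists>C. AE x in lborel. x \<in> U \<longrightarrow> norm (f x) \<le> C)}"

definition H1 ::
    "'a::euclidean_space set \<Rightarrow> ('a \<Rightarrow> 'b::euclidean_space) \<Rightarrow> ('a \<Rightarrow> 'a \<Rightarrow> 'b) \<Rightarrow> bool" where
  "H1 U f D \<longleftrightarrow> f \<in> L2 U \<and> weak_gradient U f D \<and> (\<forall>b\<in>Basis. D b \<in> L2 U)"

definition W1inf ::
    "'a::euclidean_space set \<Rightarrow> ('a \<Rightarrow> 'b::euclidean_space) \<Rightarrow> ('a \<Rightarrow> 'a \<Rightarrow> 'b) \<Rightarrow> bool" where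
  "W1inf U f D \<longleftrightarrow> f \<in> Linf U \<and> weak_gradient U f D \<and> (\<forall>b\<in>Basis. D b \<in> Linf U)"

text \<open>Functions of bounded variation on the whole space: the supremum defining the total
  variation is finite.\<close>

definition BV :: "('a::euclidean_space \<Rightarrow> real) set" where
  "BV = {f. integrable lborel f \<and>
            bdd_above {LINT x|lborel. f x * divergence \<phi> x | \<phi>. \<phi> \<in> C1c \<and> (\<forall>x. norm (\<phi> x) \<le> 1)}}"

section \<open>The variational problem\<close>

text \<open>A point \<open>(x, y, z)\<close> of three-dimensional space is written \<open>((x, y), z)\<close>. Norm and
  Lebesgue measure of the product type are the Euclidean ones.\<close>

type_synonym plane = "real \<times> real"
type_synonym space3 = "plane \<times> real"

definition Omega :: "(plane \<Rightarrow> real) \<Rightarrow> space3 set" where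
  "Omega h = {(p, z). 0 < z \<and> z < h p}"

text \<open>\<open>u = g\<close> on the flat boundary part \<open>S \<times> {0}\<close> of \<open>\<Omega>\<close>, which lies in \<open>{z > 0}\<close>, in the sense
  of traces. The trace is determined by the Gauss--Green formula; its outer normal on
  \<open>S \<times> {0}\<close> is \<open>(0, 0, -1)\<close>, so only the \<open>z\<close>-derivative produces a boundary term. Test
  functions need not vanish on \<open>S \<times> {0}\<close>, but their support avoids the rest of the boundary.
  For \<open>\<Omega> = Omega h\<close> and \<open>S = supp h\<close> with \<open>h\<close> continuous, such a test function vanishes at
  \<open>(p, 0)\<close> if \<open>p\<close> is in \<open>supp h\<close> and \<open>h p = 0\<close>, where no trace makes sense.\<close>

definition bottom_trace ::
    "space3 set \<Rightarrow> plane set \<Rightarrow> (space3 \<Rightarrow> plane) \<Rightarrow> (space3 \<Rightarrow> space3 \<Rightarrow> plane)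
      \<Rightarrow> (plane \<Rightarrow> plane) \<Rightarrow> bool" where
  "bottom_trace \<Omega> S u Du g \<longleftrightarrow>
     (\<forall>\<phi>\<in>C1c. supp \<phi> \<inter> (frontier \<Omega> - S \<times> {0}) = {} \<longrightarrow>
        (LINT x:\<Omega>|lborel. partial (0, 1) \<phi> x *\<^sub>R u x + \<phi> x *\<^sub>R Du (0, 1) x)
          = - (LINT p:S|lborel. \<phi> (p, 0) *\<^sub>R g p))"

text \<open>An element of \<open>W1inf UNIV\<close> is identified with its continuous representative, so that
  \<open>Omega h\<close> is open and \<open>supp h\<close> is well defined.\<close>

definition admissible ::
    "real \<Rightarrow> ((plane \<Rightarrow> real) \<times> (plane \<Rightarrow> plane \<Rightarrow> real)
              \<times> (space3 \<Rightarrow> plane) \<times> (space3 \<Rightarrow> space3 \<Rightarrow> plane)) set" where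
  "admissible V = {(h, Dh, u, Du).
     h \<in> BV \<and> W1inf UNIV h Dh \<and> continuous_on UNIV h \<and> (\<forall>p. 0 \<le> h p) \<and>
     (LINT p|lborel. h p) = V \<and>
     H1 (Omega h) u Du \<and> bottom_trace (Omega h) (supp h) u Du (\<lambda>p. p)}"

definition F3D :: "real \<Rightarrow> ennreal" where
  "F3D V = (INF (h, Dh, u, Du) \<in> admissible V.
     (\<integral>\<^sup>+x\<in>Omega h. ennreal ((grad_norm Du x)\<^sup>2) \<partial>lborel) +
     (\<integral>\<^sup>+p. ennreal (grad_norm Dh p) \<partial>lborel))"

end

theory Submission
  imports Defs
begin

text \<open>The two regimes come from the competition of the two energies. Over a region of diameter \<open>R\<close> the boundary
  condition at the bottom forces an elastic energy of order \<open>R\<^sup>3\<close>, or of the order of the volume if the region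
  is lower than \<open>R\<close>. A profile of volume \<open>V\<close> which is concentrated on the scale \<open>R\<close> has surface energy of
  order \<open>V / R\<close>. Balancing the two gives \<open>R = V powr (1 / 4)\<close> and energy \<open>V powr (3 / 4)\<close>, unless \<open>V\<close> is
  small, when the energy \<open>V\<close> of a rigidly stretched thin film is cheaper.

  For the upper bound (lemma \<open>F3D_le_competitor\<close>) the profile is a bump over a disc of radius \<open>R\<close>, and the
  displacement is the prescribed one, multiplied by \<open>exp (- z / R)\<close>.

  For the lower bound fix a length \<open>Z\<close>. Call a point of the domain sheltered if it lies below height \<open>Z\<close> and
  if the horizontal segment of length \<open>Z\<close> that starts there in a fixed direction stays in the domain. The ends
  of that segment can be joined inside the domain either by the segment itself or by two vertical segments and
  a piece of the bottom, where the displacement is known and changes by \<open>Z\<close>. So along paths of length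
  at most \<open>Z\<close> the gradient of \<open>u\<close> has to produce a displacement of size \<open>Z\<close>, and the elastic energy controls
  the volume of the sheltered set (lemmas \<open>sheltered_test_bound\<close> and \<open>sheltered_volume\<close>). This argument only
  uses differences over finite distances. They are obtained from the weak formulations by using averages of test
  functions along segments as test functions (lemmas \<open>weak_finite_difference\<close> and \<open>trace_finite_difference\<close>), so
  that Sobolev functions never have to be approximated by smooth ones.

  It remains to bound the sheltered volume from below in terms of the surface energy \<open>T\<close>. Unsheltered points below
  height \<open>Z\<close> have volume at most \<open>Z * T\<close>, because the integral of the oscillation of \<open>h\<close> over segments of
  length \<open>Z\<close> is bounded by \<open>Z * T\<close> (lemmas \<open>line_variation_bound\<close> and \<open>sheltered_volume_ge\<close>). If at least
  half of the volume lies below \<open>Z\<close>, this is enough. If not, the volume above \<open>Z\<close> has to be supported on a set of area at least of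
  order \<open>Z\<^sup>2\<close>, provided that \<open>Z * T\<close> is small compared with \<open>V\<close>; this isoperimetric fact follows by averaging over
  translations (lemma \<open>volume_above_level_bound\<close>). Then the sheltered set contains columns of height \<open>Z\<close> over such
  a set. With \<open>Z = V powr (1 / 4)\<close> the alternatives (lemma \<open>energy_dichotomy\<close>) give the lower bound.\<close>

section \<open>Continuously differentiable functions\<close>

definition C1 :: "('a::euclidean_space \<Rightarrow> 'b::real_normed_vector) set" where
  "C1 = {f. (\<forall>x. f differentiable (at x)) \<and> (\<forall>b\<in>Basis. continuous_on UNIV (partial b f))}"

lemma C1c_iff: "f \<in> C1c \<longleftrightarrow> f \<in> C1 \<and> compact (supp f)"
  by (auto simp: C1c_def C1_def)

lemma partial_eqI: "(f has_derivative f') (at x) \<Longrightarrow> partial b f x = f' b"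
  unfolding partial_def by (metis frechet_derivative_at)

lemma C1_has_derivative:
  assumes "f \<in> C1" shows "(f has_derivative (\<lambda>v. partial v f x)) (at x)"
  using assms frechet_derivative_works[of f "at x"] unfolding C1_def partial_def by auto

lemma C1I:
  assumes "\<And>x. (f has_derivative f' x) (at x)"
    and "\<And>b. b \<in> Basis \<Longrightarrow> continuous_on UNIV (\<lambda>x. f' x b)"
  shows "f \<in> C1"
proof -
  have "partial b f = (\<lambda>x. f' x b)" for b using partial_eqI[OF assms(1)] by auto
  thus ?thesis using assms by (auto simp: C1_def differentiable_def)
qed

lemma C1_continuous: "f \<in> C1 \<Longrightarrow> continuous_on A f"
  by (meson C1_has_derivative continuous_at_imp_continuous_on has_derivative_continuous)

lemma C1_linear_partial: "f \<in> C1 \<Longrightarrow> linear (\<lambda>v. partial v f x)"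
  using C1_has_derivative has_derivative_linear by blast

lemma partial_minus: "f \<in> C1 \<Longrightarrow> partial (- b) f x = - partial b f x"
  using linear_neg[OF C1_linear_partial] by auto

lemma C1_partial_continuous: "f \<in> C1 \<Longrightarrow> b \<in> Basis \<Longrightarrow> continuous_on A (partial b f)"
  unfolding C1_def by (auto intro: continuous_on_subset)

lemma C1_derivative_blinfun:
  fixes f :: "'a::euclidean_space \<Rightarrow> 'b::real_normed_vector"
  assumes "f \<in> C1"
  obtains f' :: "'a \<Rightarrow> 'a \<Rightarrow>\<^sub>L 'b" where "\<And>x. (f has_derivative f' x) (at x)"
    "\<And>x b. f' x b = partial b f x" "continuous_on UNIV f'"
proof
  let ?f' = "\<lambda>x. Blinfun (\<lambda>v. partial v f x)"
  have bl: "bounded_linear (\<lambda>v. partial v f x)" for x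
    using C1_has_derivative[OF assms] has_derivative_bounded_linear by blast
  show e: "?f' x b = partial b f x" for x b by (simp add: bounded_linear_Blinfun_apply[OF bl])
  show "(f has_derivative ?f' x) (at x)" for x
    unfolding e using C1_has_derivative[OF assms] .
  show "continuous_on UNIV ?f'"
    by (rule continuous_on_blinfun_componentwise) (simp add: e C1_partial_continuous[OF assms])
qed

lemma C1_scaleR:
  assumes "f \<in> C1" "g \<in> C1" shows "(\<lambda>x. f x *\<^sub>R g x) \<in> C1"
    and "partial b (\<lambda>x. f x *\<^sub>R g x) x = partial b f x *\<^sub>R g x + f x *\<^sub>R partial b g x"
proof -
  have d: "((\<lambda>x. f x *\<^sub>R g x) has_derivative
    (\<lambda>v. f x *\<^sub>R partial v g x + partial v f x *\<^sub>R g x)) (at x)" for x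
    by (intro has_derivative_scaleR C1_has_derivative assms)
  show "partial b (\<lambda>x. f x *\<^sub>R g x) x = partial b f x *\<^sub>R g x + f x *\<^sub>R partial b g x"
    using partial_eqI[OF d] by (simp add: add.commute)
  show "(\<lambda>x. f x *\<^sub>R g x) \<in> C1"
    by (rule C1I[OF d]) (intro continuous_intros C1_continuous C1_partial_continuous assms)
qed

lemma C1_compose:
  fixes g :: "real \<Rightarrow> real"
  assumes "f \<in> C1" "\<And>s. (g has_real_derivative g' s) (at s)" "continuous_on UNIV g'"
  shows "(\<lambda>x. g (f x)) \<in> C1" "partial b (\<lambda>x. g (f x)) x = g' (f x) * partial b f x"
proof -
  have d: "((\<lambda>x. g (f x)) has_derivative (\<lambda>v. partial v f x * g' (f x))) (at x)" for x
    using has_derivative_compose[OF C1_has_derivative[OF assms(1)]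
      assms(2)[unfolded has_field_derivative_def], of x] by (simp add: mult.commute)
  show "partial b (\<lambda>x. g (f x)) x = g' (f x) * partial b f x"
    using partial_eqI[OF d] by (simp add: mult.commute)
  show "(\<lambda>x. g (f x)) \<in> C1"
    by (rule C1I[OF d]) (intro continuous_intros C1_partial_continuous assms
        continuous_on_compose2[OF assms(3)] C1_continuous subset_UNIV)
qed

lemma C1_sum:
  assumes "\<And>i. i \<in> I \<Longrightarrow> f i \<in> C1" shows "(\<lambda>x. \<Sum>i\<in>I. f i x) \<in> C1"
proof -
  have d: "((\<lambda>x. \<Sum>i\<in>I. f i x) has_derivative (\<lambda>v. \<Sum>i\<in>I. partial v (f i) x)) (at x)" for x
    by (intro has_derivative_sum C1_has_derivative assms)
  show ?thesis
    by (rule C1I[OF d]) (intro continuous_intros C1_partial_continuous assms)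
qed

lemma C1_translate:
  fixes \<phi> :: "'a::euclidean_space \<Rightarrow> 'b::real_normed_vector"
  assumes "\<phi> \<in> C1" shows "(\<lambda>x. \<phi> (x - v)) \<in> C1" "partial b (\<lambda>x. \<phi> (x - v)) x = partial b \<phi> (x - v)"
proof -
  have d: "((\<lambda>x. \<phi> (x - v)) has_derivative (\<lambda>w. partial w \<phi> (x - v))) (at x)" for x
    by (rule has_derivative_compose[where f="\<lambda>x. x - v" and f'="\<lambda>w. w", OF _ C1_has_derivative[OF assms]])
       (auto intro!: derivative_eq_intros)
  show "partial b (\<lambda>x. \<phi> (x - v)) x = partial b \<phi> (x - v)" using partial_eqI[OF d] .
  show "(\<lambda>x. \<phi> (x - v)) \<in> C1"
    by (rule C1I[OF d], rule continuous_on_compose2[OF C1_partial_continuous[OF assms, of _ UNIV]])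
      (auto intro!: continuous_intros)
qed

lemma supp_zero: "x \<notin> supp f \<Longrightarrow> f x = 0"
  unfolding supp_def using closure_subset[of "{x. f x \<noteq> 0}"] by auto

lemma supp_subsetI: "closed K \<Longrightarrow> (\<And>x. x \<notin> K \<Longrightarrow> f x = 0) \<Longrightarrow> supp f \<subseteq> K"
  unfolding supp_def by (rule closure_minimal) auto

lemma compact_suppI: "compact K \<Longrightarrow> (\<And>x. x \<notin> K \<Longrightarrow> f x = 0) \<Longrightarrow> compact (supp f)"
proof -
  assume K: "compact K" "\<And>x. x \<notin> K \<Longrightarrow> f x = 0"
  have "supp f \<subseteq> K" using K by (intro supp_subsetI) (auto simp: compact_imp_closed)
  moreover have "closed (supp f)" by (simp add: supp_def)
  ultimately show ?thesis using compact_Int_closed[OF K(1), of "supp f"] by (simp add: Int_absorb1)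
qed

lemma partial_zero_outside_supp:
  assumes "x \<notin> supp f" shows "partial b f x = 0"
proof -
  have "open (- supp f)" by (auto simp: supp_def)
  hence "(f has_derivative (\<lambda>v. 0)) (at x)"
    using assms has_derivative_transform_within_open[of "\<lambda>x. 0" "\<lambda>v. 0" x UNIV "- supp f" f]
    by (auto simp: supp_zero)
  thus ?thesis by (rule partial_eqI)
qed

lemma integrable_continuous_compact_support:
  fixes f :: "'a::euclidean_space \<Rightarrow> 'b::euclidean_space"
  assumes "continuous_on UNIV f" "compact K" "\<And>x. x \<notin> K \<Longrightarrow> f x = 0"
  shows "integrable lborel f"
proof -
  have "set_integrable lborel K f"
    unfolding set_integrable_def by (rule borel_integrable_compact) (use assms in \<open>auto intro: continuous_on_subset\<close>)
  moreover have "(\<lambda>x. indicator K x *\<^sub>R f x) = f" using assms(3) by (force simp: indicator_def)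
  ultimately show ?thesis by (simp add: set_integrable_def)
qed

lemma C1c_integrable:
  fixes f :: "'a::euclidean_space \<Rightarrow> 'b::euclidean_space"
  assumes "f \<in> C1c"
  shows "integrable lborel f" "b \<in> Basis \<Longrightarrow> integrable lborel (partial b f)"
  using assms C1_continuous C1_partial_continuous partial_zero_outside_supp supp_zero
  by (auto simp: C1c_iff intro!: integrable_continuous_compact_support[where K="supp f"])

lemma continuous_bounded_compact_support:
  fixes f :: "'a::euclidean_space \<Rightarrow> 'b::real_normed_vector"
  assumes "continuous_on UNIV f" "compact K" "\<And>x. x \<notin> K \<Longrightarrow> f x = 0"
  obtains B where "\<And>x. norm (f x) \<le> B" "0 \<le> B"
proof -
  have "compact (f ` K)" using assms by (intro compact_continuous_image) (auto intro: continuous_on_subset)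
  then obtain B where "B > 0" "\<forall>x\<in>K. norm (f x) \<le> B" 
    using bounded_pos[of "f ` K"] compact_imp_bounded by auto
  hence "norm (f x) \<le> B" for x using assms(3)[of x] by (cases "x \<in> K") auto
  thus thesis using that \<open>B > 0\<close> by fastforce
qed

lemma C1c_bounded:
  fixes f :: "'a::euclidean_space \<Rightarrow> 'b::real_normed_vector"
  assumes "f \<in> C1c"
  obtains B where "\<And>x. norm (f x) \<le> B" "0 \<le> B"
proof (rule continuous_bounded_compact_support[of f "supp f"])
qed (use assms in \<open>auto simp: C1c_iff C1_continuous supp_zero\<close>)

lemma partial_bounded:
  fixes f :: "'a::euclidean_space \<Rightarrow> 'b::real_normed_vector"
  assumes "f \<in> C1c" "b \<in> Basis"
  obtains B where "\<And>x. norm (partial b f x) \<le> B" "0 \<le> B"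
proof (rule continuous_bounded_compact_support[of "partial b f" "supp f"])
qed (use assms in \<open>auto simp: C1c_iff C1_partial_continuous partial_zero_outside_supp\<close>)

section \<open>Translations and averages along segments\<close>

lemma nn_integral_translate:
  fixes g :: "'a::euclidean_space \<Rightarrow> ennreal"
  assumes [measurable]: "g \<in> borel_measurable borel"
  shows "(\<integral>\<^sup>+x. g (x + a) \<partial>lborel) = (\<integral>\<^sup>+x. g x \<partial>lborel)"
proof -
  have "(\<integral>\<^sup>+x. g x \<partial>lborel) = (\<integral>\<^sup>+x. g x \<partial>distr lborel borel ((+) a))"
    by (simp add: lborel_distr_plus)
  also have "\<dots> = (\<integral>\<^sup>+x. g (x + a) \<partial>lborel)"
    by (subst nn_integral_distr) (auto simp: add.commute)
  finally show ?thesis by simp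
qed

lemma integral_translate:
  fixes g :: "'a::euclidean_space \<Rightarrow> 'b::euclidean_space"
  shows "(LINT x|lborel. g (x + a)) = (LINT x|lborel. g x)"
    and "integrable lborel g \<Longrightarrow> integrable lborel (\<lambda>x. g (x + a))"
proof -
  have eq: "distr lborel borel (\<lambda>x. x + a) = lborel"
    using lborel_distr_plus[of a] by (subst add.commute) simp
  have iff: "integrable lborel (\<lambda>x. g (x + a)) \<longleftrightarrow> integrable lborel g" if "g \<in> borel_measurable borel"
    using integrable_distr_eq[of "\<lambda>x. x + a" lborel borel g] that unfolding eq by simp
  have meas: "g \<in> borel_measurable borel" if "(\<lambda>x. g (x + a)) \<in> borel_measurable borel"
  proof -
    have "(\<lambda>x. g ((x - a) + a)) \<in> borel_measurable borel"
      by (rule measurable_compose[OF _ that]) auto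
    thus ?thesis by simp
  qed
  show "(LINT x|lborel. g (x + a)) = (LINT x|lborel. g x)"
  proof (cases "g \<in> borel_measurable borel")
    case True
    thus ?thesis using integral_distr[of "\<lambda>x. x + a" lborel borel g] unfolding eq by simp
  next
    case False
    hence "\<not> integrable lborel g" "\<not> integrable lborel (\<lambda>x. g (x + a))" 
      using meas borel_measurable_integrable by fastforce+
    thus ?thesis by (simp add: not_integrable_integral_eq)
  qed
  show "integrable lborel g \<Longrightarrow> integrable lborel (\<lambda>x. g (x + a))"
    using iff borel_measurable_integrable by auto
qed

lemma integrable_slide:
  fixes g :: "'a::euclidean_space \<Rightarrow> 'b::euclidean_space"
  assumes g: "integrable lborel g"
  shows "integrable (lborel \<Otimes>\<^sub>M lborel) (\<lambda>(s, x). indicator {0..Z::real} s *\<^sub>R g (x + s *\<^sub>R v))"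
proof (rule integrableI_bounded)
  have [measurable]: "g \<in> borel_measurable borel" using g by auto
  have m1: "(\<lambda>(s::real, x). x + s *\<^sub>R v) \<in> borel \<Otimes>\<^sub>M borel \<rightarrow>\<^sub>M (borel :: 'a measure)" by measurable
  show m2: "(\<lambda>(s, x). indicator {0..Z} s *\<^sub>R g (x + s *\<^sub>R v)) \<in> borel_measurable (lborel \<Otimes>\<^sub>M lborel)"
    by measurable
  have "(\<integral>\<^sup>+ p. ennreal (norm (case p of (s, x) \<Rightarrow> indicator {0..Z} s *\<^sub>R g (x + s *\<^sub>R v))) \<partial>(lborel \<Otimes>\<^sub>M lborel))
    = (\<integral>\<^sup>+ s. \<integral>\<^sup>+ x. ennreal (norm (indicator {0..Z} s *\<^sub>R g (x + s *\<^sub>R v))) \<partial>lborel \<partial>lborel)"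
    using m2 by (subst lborel.nn_integral_fst[symmetric]) simp_all
  also have "\<dots> = (\<integral>\<^sup>+ s. indicator {0..Z} s * (\<integral>\<^sup>+ x. ennreal (norm (g (x + s *\<^sub>R v))) \<partial>lborel) \<partial>lborel)"
    by (intro nn_integral_cong) (auto simp: indicator_def)
  also have "\<dots> = (\<integral>\<^sup>+ s. indicator {0..Z} s * (\<integral>\<^sup>+ x. ennreal (norm (g x)) \<partial>lborel) \<partial>lborel)"
    by (subst nn_integral_translate[where g="\<lambda>x. ennreal (norm (g x))"]) auto
  also have "\<dots> = emeasure lborel {0..Z} * (\<integral>\<^sup>+ x. ennreal (norm (g x)) \<partial>lborel)"
    by (subst nn_integral_multc) auto
  also have "\<dots> < \<infinity>"
    using g by (auto simp: integrable_iff_bounded ennreal_mult_less_top emeasure_lborel_Icc_eq)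
  finally show "(\<integral>\<^sup>+ p. ennreal (norm (case p of (s, x) \<Rightarrow> indicator {0..Z} s *\<^sub>R g (x + s *\<^sub>R v)))
    \<partial>(lborel \<Otimes>\<^sub>M lborel)) < \<infinity>" .
qed

text \<open>The integral of \<open>\<phi>\<close> over the segment from \<open>x\<close> back to \<open>x - Z *\<^sub>R v\<close>, that is, the convolution of \<open>\<phi>\<close>
  with Lebesgue measure on a segment. Its derivative along \<open>v\<close> is a difference of \<open>\<phi>\<close> over the
  distance \<open>Z\<close>. As a test function it therefore turns statements about weak derivatives into statements
  about differences over a finite distance, without any mollification.\<close>
definition slide :: "real \<Rightarrow> 'a::euclidean_space \<Rightarrow> ('a \<Rightarrow> 'b::euclidean_space) \<Rightarrow> 'a \<Rightarrow> 'b" where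
  "slide Z v \<phi> x = integral {0..Z} (\<lambda>s. \<phi> (x - s *\<^sub>R v))"

lemma slide_has_derivative:
  assumes "\<phi> \<in> C1"
  shows "(slide Z v \<phi> has_derivative (\<lambda>b. integral {0..Z} (\<lambda>s. partial b \<phi> (x - s *\<^sub>R v)))) (at x)"
proof -
  obtain f' where f': "\<And>x. (\<phi> has_derivative blinfun_apply (f' x)) (at x)"
    "\<And>x b. blinfun_apply (f' x) b = partial b \<phi> x" "continuous_on UNIV f'"
    using C1_derivative_blinfun[OF assms] by metis
  have c: "continuous_on A (\<lambda>s. f' (x - s *\<^sub>R v))" for x A
    by (rule continuous_on_compose2[OF f'(3)]) (auto intro!: continuous_intros)
  have "((\<lambda>x. integral (cbox 0 Z) (\<lambda>s. \<phi> (x - s *\<^sub>R v))) has_derivative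
    integral (cbox 0 Z) (\<lambda>s. f' (x - s *\<^sub>R v))) (at x within UNIV)"
  proof (rule leibniz_rule[where fx="\<lambda>x s. f' (x - s *\<^sub>R v)"])
    show "((\<lambda>x. \<phi> (x - t *\<^sub>R v)) has_derivative blinfun_apply (f' (x - t *\<^sub>R v))) (at x)" for x t
      using C1_has_derivative[OF C1_translate(1)[OF assms]] C1_translate(2)[OF assms]
      unfolding f'(2)[abs_def] by (simp add: f'(2))
    show "(\<lambda>s. \<phi> (x - s *\<^sub>R v)) integrable_on cbox 0 Z" for x
      by (intro integrable_continuous continuous_on_compose2[OF C1_continuous[OF assms]])
        (auto intro!: continuous_intros)
    show "continuous_on (UNIV \<times> cbox 0 Z) (\<lambda>(x, s). f' (x - s *\<^sub>R v))"
      unfolding split_beta by (rule continuous_on_compose2[OF f'(3)]) (auto intro!: continuous_intros)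
  qed auto
  moreover have "blinfun_apply (integral (cbox 0 Z) (\<lambda>s. f' (x - s *\<^sub>R v))) b
      = integral {0..Z} (\<lambda>s. partial b \<phi> (x - s *\<^sub>R v))" for b
    by (subst blinfun_apply_integral) (auto simp: f'(2) intro!: integrable_continuous_real c)
  hence "blinfun_apply (integral (cbox 0 Z) (\<lambda>s. f' (x - s *\<^sub>R v))) =
      (\<lambda>b. integral {0..Z} (\<lambda>s. partial b \<phi> (x - s *\<^sub>R v)))" by (rule ext)
  ultimately show ?thesis unfolding slide_def[abs_def] by simp
qed

lemma slide_C1: 
  assumes "\<phi> \<in> C1" shows "slide Z v \<phi> \<in> C1"
proof (rule C1I[OF slide_has_derivative[OF assms]])
  fix b :: 'a assume b: "b \<in> Basis"
  have "continuous_on UNIV (\<lambda>x. integral (cbox 0 Z) (\<lambda>s. partial b \<phi> (x - s *\<^sub>R v)))"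
    by (rule integral_continuous_on_param, unfold split_beta,
        rule continuous_on_compose2[OF C1_partial_continuous[OF assms b]])
      (auto intro!: continuous_intros)
  thus "continuous_on UNIV (\<lambda>x. integral {0..Z} (\<lambda>s. partial b \<phi> (x - s *\<^sub>R v)))" by simp
qed

text \<open>Along the segment the derivative of \<open>\<phi>\<close> integrates to the difference of the values at its ends.\<close>
lemma partial_slide:
  assumes "\<phi> \<in> C1" "0 \<le> Z" 
  shows "partial v (slide Z v \<phi>) x = \<phi> x - \<phi> (x - Z *\<^sub>R v)"
proof -
  have d: "((\<lambda>s. - \<phi> (x - s *\<^sub>R v)) has_vector_derivative partial v \<phi> (x - s *\<^sub>R v)) (at s within {0..Z})" for s
  proof -
    have "((\<lambda>s. - \<phi> (x - s *\<^sub>R v)) has_derivative (\<lambda>t. - partial (- t *\<^sub>R v) \<phi> (x - s *\<^sub>R v))) (at s within {0..Z})"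
      by (rule has_derivative_minus, rule has_derivative_compose[OF _ C1_has_derivative[OF assms(1)]])
        (auto intro!: derivative_eq_intros)
    moreover have "- partial (- t *\<^sub>R v) \<phi> y = t *\<^sub>R partial v \<phi> y" for t y
      using linear_scale[OF C1_linear_partial[OF assms(1)], of "-t" v y] by simp
    ultimately show ?thesis unfolding has_vector_derivative_def by simp
  qed
  have "((\<lambda>s. partial v \<phi> (x - s *\<^sub>R v)) has_integral (- \<phi> (x - Z *\<^sub>R v)) - (- \<phi> (x - 0 *\<^sub>R v))) {0..Z}"
    by (rule fundamental_theorem_of_calculus[OF assms(2)]) (rule d)
  hence "integral {0..Z} (\<lambda>s. partial v \<phi> (x - s *\<^sub>R v)) = \<phi> x - \<phi> (x - Z *\<^sub>R v)"
    by (simp add: integral_unique)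
  thus ?thesis using partial_eqI[OF slide_has_derivative[OF assms(1)]] by metis
qed

lemma slide_eq_0:
  assumes "\<And>s. s \<in> {0..Z} \<Longrightarrow> \<phi> (x - s *\<^sub>R v) = 0" shows "slide Z v \<phi> x = 0"
  unfolding slide_def using integral_cong[of "{0..Z}" "\<lambda>s. \<phi> (x - s *\<^sub>R v)" "\<lambda>s. 0"] assms by simp

lemma compact_swept:
  fixes K :: "'a::euclidean_space set"
  shows "compact K \<Longrightarrow> compact {y + s *\<^sub>R v | y s. y \<in> K \<and> s \<in> {0..Z::real}}"
proof -
  assume "compact K"
  hence "compact ((\<lambda>(y, s). y + s *\<^sub>R v) ` (K \<times> {0..Z}))"
    by (intro compact_continuous_image compact_Times) (auto simp: split_beta intro!: continuous_intros)
  moreover have "(\<lambda>(y, s). y + s *\<^sub>R v) ` (K \<times> {0..Z}) = {y + s *\<^sub>R v | y s. y \<in> K \<and> s \<in> {0..Z}}"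
    by (auto simp: image_iff; metis)
  ultimately show ?thesis by simp
qed

lemma supp_slide:
  assumes "compact (supp \<phi>)"
  shows "supp (slide Z v \<phi>) \<subseteq> {y + s *\<^sub>R v | y s. y \<in> supp \<phi> \<and> s \<in> {0..Z}}"
proof (rule supp_subsetI)
  show "closed {y + s *\<^sub>R v | y s. y \<in> supp \<phi> \<and> s \<in> {0..Z}}"
    using compact_swept[OF assms] compact_imp_closed by blast
  fix x assume "x \<notin> {y + s *\<^sub>R v | y s. y \<in> supp \<phi> \<and> s \<in> {0..Z}}"
  hence "x - s *\<^sub>R v \<notin> supp \<phi>" if "s \<in> {0..Z}" for s using that by (metis (mono_tags, lifting) diff_add_cancel mem_Collect_eq)
  thus "slide Z v \<phi> x = 0" by (intro slide_eq_0 supp_zero)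
qed

lemma slide_C1c:
  assumes "\<phi> \<in> C1c" shows "slide Z v \<phi> \<in> C1c"
proof -
  have "compact (supp (slide Z v \<phi>))"
    using compact_Int_closed[OF compact_swept, of "supp \<phi>" "supp (slide Z v \<phi>)" v Z] supp_slide[of \<phi> Z v] assms
    by (simp add: C1c_iff Int_absorb1 supp_def)
  thus ?thesis using assms slide_C1 C1c_iff by blast
qed

lemma slide_lebesgue:
  assumes "\<phi> \<in> C1" shows "slide Z v \<phi> x = (LINT s|lborel. indicator {0..Z} s *\<^sub>R \<phi> (x - s *\<^sub>R v))"
proof -
  have "set_integrable lborel {0..Z} (\<lambda>s. \<phi> (x - s *\<^sub>R v))"
    unfolding set_integrable_def by (rule borel_integrable_compact)
       (auto intro!: continuous_on_compose2[OF C1_continuous[OF assms, of UNIV]] continuous_intros)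
  from set_borel_integral_eq_integral(2)[OF this] show ?thesis
    by (simp add: slide_def set_lebesgue_integral_def)
qed

text \<open>Fubini and a translation move the average from the test function to \<open>g\<close>. The integral over \<open>s\<close> is
  kept outside, so that estimates can be made for each translate of \<open>g\<close> separately; these all have the
  same norm.\<close>
lemma integral_slide:
  fixes g :: "'a::euclidean_space \<Rightarrow> 'b::euclidean_space" and \<phi> :: "'a \<Rightarrow> real"
  assumes \<phi>: "\<phi> \<in> C1c" and g: "integrable lborel g"
  shows "(LINT x|lborel. slide Z v \<phi> x *\<^sub>R g x) =
    (LINT s|lborel. indicator {0..Z} s *\<^sub>R (LINT x|lborel. \<phi> x *\<^sub>R g (x + s *\<^sub>R v)))"
proof -
  have \<phi>1: "\<phi> \<in> C1" using \<phi> by (simp add: C1c_iff)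
  have [measurable]: "\<phi> \<in> borel_measurable borel" "g \<in> borel_measurable borel"
    using C1c_integrable(1)[OF \<phi>] g by auto
  obtain B where B: "\<And>x. norm (\<phi> x) \<le> B" "0 \<le> B" using C1c_bounded[OF \<phi>] by metis
  let ?F = "\<lambda>s x. (indicator {0..Z} s * \<phi> (x - s *\<^sub>R v)) *\<^sub>R g x"
  have int: "integrable (lborel \<Otimes>\<^sub>M lborel) (\<lambda>(s, x). ?F s x)"
  proof (rule Bochner_Integration.integrable_bound)
    show "integrable (lborel \<Otimes>\<^sub>M lborel) (\<lambda>(s, x). B *\<^sub>R (indicator {0..Z} s *\<^sub>R g (x + s *\<^sub>R 0)))"
      using integrable_scaleR_right[OF integrable_slide[OF g, of Z 0], of B] by (simp add: case_prod_unfold)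
    show "AE p in lborel \<Otimes>\<^sub>M lborel. norm (case p of (s, x) \<Rightarrow> ?F s x) \<le>
      norm (case p of (s, x) \<Rightarrow> B *\<^sub>R (indicator {0..Z} s *\<^sub>R g (x + s *\<^sub>R 0)))"
      using B by (auto simp: abs_mult split: split_indicator intro!: AE_I2 mult_right_mono)
  qed measurable
  have "(LINT x|lborel. slide Z v \<phi> x *\<^sub>R g x) = (LINT x|lborel. LINT s|lborel. ?F s x)"
  proof (rule Bochner_Integration.integral_cong[OF refl])
    fix x
    have "integrable lborel (\<lambda>s. indicator {0..Z} s * \<phi> (x - s *\<^sub>R v))"
      unfolding real_scaleR_def[symmetric] by (rule borel_integrable_compact) (auto intro!: continuous_on_compose2[OF C1_continuous[OF \<phi>1, of UNIV]] continuous_intros)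
    thus "slide Z v \<phi> x *\<^sub>R g x = (LINT s|lborel. ?F s x)" by (simp add: slide_lebesgue[OF \<phi>1])
  qed
  also have "\<dots> = (LINT s|lborel. LINT x|lborel. ?F s x)"
    using lborel_pair.Fubini_integral[OF int] by simp
  also have "\<dots> = (LINT s|lborel. indicator {0..Z} s *\<^sub>R (LINT x|lborel. \<phi> x *\<^sub>R g (x + s *\<^sub>R v)))"
  proof (rule Bochner_Integration.integral_cong[OF refl])
    fix s :: real
    have "(LINT x|lborel. ?F s x) = (LINT x|lborel. ?F s (x + s *\<^sub>R v))"
      by (rule integral_translate(1)[symmetric])
    also have "\<dots> = indicator {0..Z} s *\<^sub>R (LINT x|lborel. \<phi> x *\<^sub>R g (x + s *\<^sub>R v))"
      by (auto simp: indicator_def)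
    finally show "(LINT x|lborel. ?F s x) = indicator {0..Z} s *\<^sub>R (LINT x|lborel. \<phi> x *\<^sub>R g (x + s *\<^sub>R v))" .
  qed
  finally show ?thesis .
qed

section \<open>Integration by parts\<close>

text \<open>Integrating \<open>partial b \<psi>\<close> over unit segments gives the difference of two translates of \<open>\<psi>\<close>, which have
  the same integral; by Fubini, averaging over translates has not changed the integral.\<close>
lemma integral_partial_eq_0:
  fixes \<psi> :: "'a::euclidean_space \<Rightarrow> 'b::euclidean_space"
  assumes \<psi>: "\<psi> \<in> C1c" and b: "b \<in> Basis"
  shows "(LINT x|lborel. partial b \<psi> x) = 0"
proof -
  have \<psi>1: "\<psi> \<in> C1" using \<psi> by (simp add: C1c_iff)
  let ?F = "\<lambda>s x. indicator {0..1::real} s *\<^sub>R partial b \<psi> (x + s *\<^sub>R b)"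
  have slide: "(LINT s|lborel. ?F s x) = \<psi> (x + b) - \<psi> x" for x
  proof -
    have d: "((\<lambda>s. \<psi> (x + s *\<^sub>R b)) has_vector_derivative partial b \<psi> (x + s *\<^sub>R b)) (at s within {0..1})" for s
    proof -
      have "((\<lambda>s. \<psi> (x + s *\<^sub>R b)) has_derivative (\<lambda>t. partial (t *\<^sub>R b) \<psi> (x + s *\<^sub>R b))) (at s within {0..1})"
        by (rule has_derivative_compose[OF _ C1_has_derivative[OF \<psi>1]])
          (auto intro!: derivative_eq_intros)
      moreover have "partial (t *\<^sub>R b) \<psi> y = t *\<^sub>R partial b \<psi> y" for t y
        using linear_scale[OF C1_linear_partial[OF \<psi>1]] by simp
      ultimately show ?thesis unfolding has_vector_derivative_def by simp
    qed
    have "((\<lambda>s. partial b \<psi> (x + s *\<^sub>R b)) has_integral \<psi> (x + 1 *\<^sub>R b) - \<psi> (x + 0 *\<^sub>R b)) {0..1}"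
      by (rule fundamental_theorem_of_calculus) (auto intro: d)
    moreover have "set_integrable lborel {0..1} (\<lambda>s. partial b \<psi> (x + s *\<^sub>R b))"
      unfolding set_integrable_def by (rule borel_integrable_compact)
        (auto intro!: continuous_on_compose2[OF C1_partial_continuous[OF \<psi>1 b, of UNIV]] continuous_intros)
    ultimately show ?thesis
      using set_borel_integral_eq_integral(2)[of "{0..1}" "\<lambda>s. partial b \<psi> (x + s *\<^sub>R b)"]
      by (simp add: set_lebesgue_integral_def integral_unique)
  qed
  have int: "integrable (lborel \<Otimes>\<^sub>M lborel) (\<lambda>(s, x). ?F s x)"
    by (rule integrable_slide[OF C1c_integrable(2)[OF \<psi> b]])
  have "0 = (LINT x|lborel. \<psi> (x + b) - \<psi> x)"
    using integral_translate[of \<psi> b] C1c_integrable(1)[OF \<psi>] by simp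
  also have "\<dots> = (LINT s|lborel. LINT x|lborel. ?F s x)"
    using lborel_pair.Fubini_integral[OF int] by (simp add: slide)
  also have "\<dots> = (LINT s|lborel. indicator {0..1::real} s *\<^sub>R (LINT x|lborel. partial b \<psi> x))"
    by (intro Bochner_Integration.integral_cong refl)
       (auto simp: integral_translate(1)[where g="partial b \<psi>"] indicator_def)
  also have "\<dots> = (LINT x|lborel. partial b \<psi> x)" by simp
  finally show ?thesis by simp
qed

lemma C1c_scaleR:
  assumes "\<phi> \<in> C1c" "f \<in> C1" shows "(\<lambda>x. \<phi> x *\<^sub>R f x) \<in> C1c"
proof -
  have "compact (supp (\<lambda>x. \<phi> x *\<^sub>R f x))"
    using assms by (intro compact_suppI[where K="supp \<phi>" and f="\<lambda>x. \<phi> x *\<^sub>R f x"]) (auto simp: C1c_iff supp_zero)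
  thus ?thesis using assms C1_scaleR(1) by (auto simp: C1c_iff)
qed

lemma C1_integration_by_parts:
  fixes f :: "'a::euclidean_space \<Rightarrow> 'b::euclidean_space"
  assumes \<phi>: "\<phi> \<in> C1c" and f: "f \<in> C1" and b: "b \<in> Basis"
  shows "(LINT x|lborel. partial b \<phi> x *\<^sub>R f x) = - (LINT x|lborel. \<phi> x *\<^sub>R partial b f x)"
proof -
  have \<phi>1: "\<phi> \<in> C1" "compact (supp \<phi>)" using \<phi> by (auto simp: C1c_iff)
  have "integrable lborel (\<lambda>x. partial b \<phi> x *\<^sub>R f x)" "integrable lborel (\<lambda>x. \<phi> x *\<^sub>R partial b f x)"
    by (rule integrable_continuous_compact_support[OF _ \<phi>1(2)],
      intro continuous_on_scaleR C1_continuous C1_partial_continuous f b \<phi>1(1),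
      simp add: supp_zero partial_zero_outside_supp)+
  hence "(LINT x|lborel. partial b (\<lambda>x. \<phi> x *\<^sub>R f x) x) =
     (LINT x|lborel. partial b \<phi> x *\<^sub>R f x) + (LINT x|lborel. \<phi> x *\<^sub>R partial b f x)"
    by (simp add: C1_scaleR(2)[OF \<phi>1(1) f])
  thus ?thesis using integral_partial_eq_0[OF C1c_scaleR[OF \<phi> f] b] by (simp add: eq_neg_iff_add_eq_0)
qed

lemma integrable_continuous_compact:
  fixes f :: "'a::euclidean_space \<Rightarrow> 'b::euclidean_space"
  assumes "continuous_on UNIV f" "compact K" shows "set_integrable lborel K f"
  unfolding set_integrable_def using assms by (intro borel_integrable_compact) (auto intro: continuous_on_subset)

lemma C1_weak_gradient:
  fixes f :: "'a::euclidean_space \<Rightarrow> 'b::euclidean_space"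
  assumes f: "f \<in> C1" 
  shows "weak_gradient U f (\<lambda>b. partial b f)"
  unfolding weak_gradient_def locally_integrable_def
proof (intro conjI ballI allI impI)
  show "set_integrable lborel K f" if "compact K \<and> K \<subseteq> U" for K
    using that f by (intro integrable_continuous_compact C1_continuous) auto
  fix b :: 'a assume b: "b \<in> Basis"
  show "set_integrable lborel K (partial b f)" if "compact K \<and> K \<subseteq> U" for K
    using that f b by (intro integrable_continuous_compact C1_partial_continuous) auto
  fix \<phi> :: "'a \<Rightarrow> real" assume \<phi>: "\<phi> \<in> C1c" "supp \<phi> \<subseteq> U"
  have "indicator U x *\<^sub>R (partial b \<phi> x *\<^sub>R f x) = partial b \<phi> x *\<^sub>R f x" 
    "indicator U x *\<^sub>R (\<phi> x *\<^sub>R partial b f x) = \<phi> x *\<^sub>R partial b f x" for x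
    using \<phi>(2) supp_zero[of x \<phi>] partial_zero_outside_supp[of x \<phi> b]
    by (cases "x \<in> supp \<phi>"; auto)+
  thus "(LINT x:U|lborel. partial b \<phi> x *\<^sub>R f x) = - (LINT x:U|lborel. \<phi> x *\<^sub>R partial b f x)"
    using C1_integration_by_parts[OF \<phi>(1) f b] by (simp only: set_lebesgue_integral_def)
qed

section \<open>Cut-off functions\<close>

lemma max_square_has_derivative: "((\<lambda>s::real. (max 0 s)\<^sup>2) has_real_derivative 2 * max 0 s) (at s)"
proof (cases "s = 0")
  case True
  have "((\<lambda>h::real. max 0 h) \<longlongrightarrow> max 0 0) (at 0)" by (intro tendsto_intros)
  moreover have "eventually (\<lambda>h::real. max 0 h = ((max 0 (0 + h))\<^sup>2 - (max 0 0)\<^sup>2) / h) (at 0)"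
    by (auto simp: eventually_at_filter max_def power2_eq_square)
  ultimately have "((\<lambda>s::real. (max 0 s)\<^sup>2) has_real_derivative 0) (at 0)"
    unfolding DERIV_def by (simp add: tendsto_cong)
  thus ?thesis using True by simp
next
  case False
  show ?thesis
  proof (cases "s > 0")
    case True
    have "((\<lambda>s::real. s\<^sup>2) has_real_derivative 2 * s) (at s)"
      by (auto intro!: derivative_eq_intros)
    hence "((\<lambda>s::real. (max 0 s)\<^sup>2) has_real_derivative 2 * s) (at s)"
      by (rule has_field_derivative_transform_within_open[where S="{0<..}"]) (use True in auto)
    thus ?thesis using True by simp
  next
    case f: False
    have "((\<lambda>s::real. 0) has_real_derivative 0) (at s)" by simp
    hence "((\<lambda>s::real. (max 0 s)\<^sup>2) has_real_derivative 0) (at s)"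
      by (rule has_field_derivative_transform_within_open[where S="{..<0}"]) (use f False in auto)
    thus ?thesis using f by simp
  qed
qed

text \<open>Squaring the positive part makes the truncated paraboloid continuously differentiable.\<close>
definition bump :: "'a::euclidean_space \<Rightarrow> real \<Rightarrow> 'a \<Rightarrow> real" where
  "bump a r x = (max 0 (1 - (norm (x - a))\<^sup>2 / r\<^sup>2))\<^sup>2"

lemma paraboloid_C1:
  fixes a :: "'a::euclidean_space"
  assumes "r > 0"
  shows "(\<lambda>x. 1 - (norm (x - a))\<^sup>2 / r\<^sup>2) \<in> C1"
    "partial b (\<lambda>x. 1 - (norm (x - a))\<^sup>2 / r\<^sup>2) x = - 2 * ((x - a) \<bullet> b) / r\<^sup>2"
proof -
  have d: "((\<lambda>x. 1 - (norm (x - a))\<^sup>2 / r\<^sup>2) has_derivative (\<lambda>b. - 2 * ((x - a) \<bullet> b) / r\<^sup>2)) (at x)" for x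
    unfolding power2_norm_eq_inner using assms
    by (auto intro!: derivative_eq_intros ext simp: inner_commute field_simps)
  show "(\<lambda>x. 1 - (norm (x - a))\<^sup>2 / r\<^sup>2) \<in> C1"
    by (rule C1I[OF d]) (use assms in \<open>auto intro!: continuous_intros\<close>)
  show "partial b (\<lambda>x. 1 - (norm (x - a))\<^sup>2 / r\<^sup>2) x = - 2 * ((x - a) \<bullet> b) / r\<^sup>2"
    by (rule partial_eqI[OF d])
qed

lemma
  fixes a :: "'a::euclidean_space"
  assumes "r > 0"
  shows bump_C1: "bump a r \<in> C1"
    and partial_bump: "partial b (bump a r) x =
      2 * max 0 (1 - (norm (x - a))\<^sup>2 / r\<^sup>2) * (- 2 * ((x - a) \<bullet> b) / r\<^sup>2)"
proof -
  have e: "bump a r = (\<lambda>x. (max 0 (1 - (norm (x - a))\<^sup>2 / r\<^sup>2))\<^sup>2)" by (simp add: bump_def fun_eq_iff)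
  have c: "continuous_on UNIV (\<lambda>s::real. 2 * max 0 s)" by (intro continuous_intros)
  note * = C1_compose[OF paraboloid_C1(1)[OF assms, of a] max_square_has_derivative c]
  show "bump a r \<in> C1" unfolding e by (rule *(1))
  show "partial b (bump a r) x = 2 * max 0 (1 - (norm (x - a))\<^sup>2 / r\<^sup>2) * (- 2 * ((x - a) \<bullet> b) / r\<^sup>2)"
    unfolding e *(2) paraboloid_C1(2)[OF assms] ..
qed

lemma bump_nonneg: "0 \<le> bump a r x" by (simp add: bump_def)

lemma bump_outside: "r > 0 \<Longrightarrow> x \<notin> ball a r \<Longrightarrow> bump a r x = 0"
proof -
  assume "r > 0" "x \<notin> ball a r"
  hence "r\<^sup>2 \<le> (norm (x - a))\<^sup>2" by (auto simp: dist_norm norm_minus_commute intro!: power_mono)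
  thus ?thesis using \<open>r > 0\<close> by (simp add: bump_def max_def field_simps)
qed

lemma bump_le_1: "bump a r x \<le> 1"
proof -
  have "max 0 (1 - (norm (x - a))\<^sup>2 / r\<^sup>2) \<le> 1" by simp
  thus ?thesis unfolding bump_def by (simp add: power_le_one)
qed

lemma bump_ge_half:
  assumes "r > 0" "x \<in> ball a (r / 2)" shows "1 / 2 \<le> bump a r x"
proof -
  have "(norm (x - a))\<^sup>2 \<le> (r / 2)\<^sup>2" using assms by (intro power_mono) (auto simp: dist_norm norm_minus_commute)
  hence "(norm (x - a))\<^sup>2 / r\<^sup>2 \<le> 1 / 4" using assms by (simp add: field_simps)
  hence "3 / 4 \<le> max 0 (1 - (norm (x - a))\<^sup>2 / r\<^sup>2)" by linarith
  hence "(3 / 4)\<^sup>2 \<le> bump a r x" unfolding bump_def by (rule power_mono) simp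
  thus ?thesis by (simp add: power2_eq_square)
qed

lemma bump_C1c: assumes "r > 0" shows "bump a r \<in> C1c"
proof -
  have "compact (supp (bump a r))"
    by (rule compact_suppI[OF compact_cball[of a r]], rule bump_outside) (use assms in auto)
  thus ?thesis using bump_C1[OF assms] C1c_iff by blast
qed

text \<open>A sum of bumps over a finite cover of \<open>K\<close> by balls is at least \<open>1\<close> on \<open>K\<close>; composing it with
  \<open>s \<mapsto> 1 - (max 0 (1 - s))\<^sup>2\<close> truncates it at \<open>1\<close> in a continuously differentiable way.\<close>
lemma cutoff_exists:
  fixes K U :: "'a::euclidean_space set"
  assumes "compact K" "open U" "K \<subseteq> U"
  obtains \<phi> :: "'a \<Rightarrow> real" where "\<phi> \<in> C1c" "\<And>x. 0 \<le> \<phi> x" "\<And>x. \<phi> x \<le> 1" "supp \<phi> \<subseteq> U"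
    "\<And>x. x \<in> K \<Longrightarrow> \<phi> x = 1"
proof -
  have "\<forall>a\<in>K. \<exists>r>0. cball a r \<subseteq> U" using assms open_contains_cball by blast
  then obtain r where r: "\<And>a. a \<in> K \<Longrightarrow> r a > 0" "\<And>a. a \<in> K \<Longrightarrow> cball a (r a) \<subseteq> U" by metis
  have "K \<subseteq> (\<Union>a\<in>K. ball a (r a / 2))" using r(1) by fastforce
  then obtain F where F: "F \<subseteq> K" "finite F" "K \<subseteq> (\<Union>a\<in>F. ball a (r a / 2))"
    using compactE_image[OF assms(1), of K "\<lambda>a. ball a (r a / 2)"] by auto
  define \<psi> where "\<psi> x = (\<Sum>a\<in>F. 2 * bump a (r a) x)" for x
  define \<phi> where "\<phi> x = 1 - (max 0 (1 - \<psi> x))\<^sup>2" for x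
  have "(\<lambda>x. 2 * bump a (r a) x) \<in> C1" if "a \<in> F" for a
    by (rule C1_compose(1)[OF bump_C1, where g="\<lambda>s. 2 * s" and g'="\<lambda>s. 2"])
      (use that F(1) r(1) in \<open>auto intro!: derivative_eq_intros\<close>)
  hence "\<psi> \<in> C1" unfolding \<psi>_def[abs_def] by (rule C1_sum)
  moreover have "((\<lambda>s::real. 1 - (max 0 (1 - s))\<^sup>2) has_real_derivative 2 * max 0 (1 - s)) (at s)" for s
    using DERIV_diff[OF DERIV_const DERIV_chain2[OF max_square_has_derivative
        DERIV_diff[OF DERIV_const DERIV_ident]], of 1 1 s UNIV] by simp
  ultimately have \<phi>1: "\<phi> \<in> C1" unfolding \<phi>_def[abs_def]
    by (rule C1_compose(1)[where g="\<lambda>s. 1 - (max 0 (1 - s))\<^sup>2" and g'="\<lambda>s. 2 * max 0 (1 - s)"])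
      (intro continuous_intros)
  have \<psi>0: "0 \<le> \<psi> x" for x unfolding \<psi>_def by (intro sum_nonneg) (auto simp: bump_nonneg)
  let ?C = "\<Union>a\<in>F. cball a (r a)"
  have C: "compact ?C" using F(2) by (intro compact_UN) auto
  have out: "\<phi> x = 0" if "x \<notin> ?C" for x
  proof -
    have "bump a (r a) x = 0" if "a \<in> F" for a
      using that \<open>x \<notin> ?C\<close> F(1) r(1) by (intro bump_outside) auto
    hence "\<psi> x = 0" by (simp add: \<psi>_def)
    thus ?thesis by (simp add: \<phi>_def)
  qed
  have "supp \<phi> \<subseteq> ?C" by (rule supp_subsetI[OF compact_imp_closed[OF C] out])
  also have "?C \<subseteq> U" using F(1) r(2) by blast
  finally have s: "supp \<phi> \<subseteq> U" .
  have one: "\<phi> x = 1" if "x \<in> K" for x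
  proof -
    obtain a where a: "a \<in> F" "x \<in> ball a (r a / 2)" using F(3) \<open>x \<in> K\<close> by (meson UN_E subsetD)
    hence "1 \<le> 2 * bump a (r a) x" using bump_ge_half[of "r a" x a] F(1) r(1) by fastforce
    also have "\<dots> \<le> \<psi> x" unfolding \<psi>_def using F(2) a by (intro member_le_sum) (auto simp: bump_nonneg)
    finally show ?thesis by (simp add: \<phi>_def)
  qed
  have "\<phi> \<in> C1c" using \<phi>1 compact_suppI[OF C out] by (simp add: C1c_iff)
  moreover have "0 \<le> \<phi> x" "\<phi> x \<le> 1" for x
    using \<psi>0[of x] by (auto simp: \<phi>_def power_le_one)
  ultimately show thesis using that s one by blast
qed

lemma cutoffs_tendsto_indicator:
  fixes U :: "'a::euclidean_space set"
  assumes "open U"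
  obtains \<phi> :: "nat \<Rightarrow> 'a \<Rightarrow> real" where "\<And>n. \<phi> n \<in> C1c" "\<And>n x. 0 \<le> \<phi> n x" "\<And>n x. \<phi> n x \<le> 1"
    "\<And>n. supp (\<phi> n) \<subseteq> U" "\<And>x. (\<lambda>n. \<phi> n x) \<longlonglongrightarrow> indicator U x"
proof -
  obtain C where C: "\<And>n::nat. compact (C n)" "\<And>n. C n \<subseteq> U" 
    "\<And>K. compact K \<Longrightarrow> K \<subseteq> U \<Longrightarrow> \<exists>N. \<forall>n\<ge>N. K \<subseteq> C n"
    using open_Union_compact_subsets[OF assms] by metis
  have "\<forall>n. \<exists>\<phi>. \<phi> \<in> C1c \<and> (\<forall>x. 0 \<le> \<phi> x) \<and> (\<forall>x. \<phi> x \<le> (1::real)) \<and> supp \<phi> \<subseteq> U \<and> (\<forall>x\<in>C n. \<phi> x = 1)"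
    using cutoff_exists[OF C(1) assms C(2)] by metis
  then obtain \<phi> :: "nat \<Rightarrow> 'a \<Rightarrow> real" where \<phi>: "\<And>n. \<phi> n \<in> C1c" "\<And>n x. 0 \<le> \<phi> n x" "\<And>n x. \<phi> n x \<le> 1"
    "\<And>n. supp (\<phi> n) \<subseteq> U" "\<And>n x. x \<in> C n \<Longrightarrow> \<phi> n x = 1" by metis
  have "(\<lambda>n. \<phi> n x) \<longlonglongrightarrow> indicator U x" for x
  proof (cases "x \<in> U")
    case True
    then obtain N where "\<forall>n\<ge>N. x \<in> C n" using C(3)[of "{x}"] by auto
    hence "eventually (\<lambda>n. indicator U x = \<phi> n x) sequentially"
      using \<phi>(5) True by (auto simp: eventually_sequentially)
    thus ?thesis using tendsto_cong[of "\<lambda>n. indicator U x"] by fastforce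
  next
    case False
    hence "\<phi> n x = 0" for n using \<phi>(4)[of n] by (intro supp_zero) auto
    thus ?thesis using False by simp
  qed
  thus thesis using that \<phi> by blast
qed

text \<open>Testing with cut-offs that converge to the indicator of an open set shows that \<open>q\<close> integrates to zero
  over every open set. The open sets are stable under intersections and generate the Borel sets, so \<open>q\<close>
  integrates to zero over every Borel set.\<close>
lemma fundamental_lemma_of_variations:
  fixes q :: "'a::euclidean_space \<Rightarrow> real"
  assumes q: "integrable lborel q" and 0: "\<And>\<phi>. \<phi> \<in> C1c \<Longrightarrow> (LINT x|lborel. \<phi> x * q x) = 0"
  shows "AE x in lborel. q x = 0"
proof (rule sigma_finite_measure.density_zero[OF sigma_finite_lborel q])
  have si: "set_integrable lborel A q" if "A \<in> sets borel" for A
    unfolding set_integrable_def using q that by (intro integrable_mult_indicator) auto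
  have op: "set_lebesgue_integral lborel U q = 0" if U: "open U" for U
  proof -
    obtain \<phi> :: "nat \<Rightarrow> 'a \<Rightarrow> real" where \<phi>: "\<And>n. \<phi> n \<in> C1c" "\<And>n x. 0 \<le> \<phi> n x" "\<And>n x. \<phi> n x \<le> 1"
      "\<And>x. (\<lambda>n. \<phi> n x) \<longlonglongrightarrow> indicator U x"
      using cutoffs_tendsto_indicator[OF U] by metis
    have "(\<lambda>n. LINT x|lborel. \<phi> n x * q x) \<longlonglongrightarrow> (LINT x|lborel. indicator U x * q x)"
    proof (rule integral_dominated_convergence[where w="\<lambda>x. norm (q x)"])
      show "(\<lambda>x. \<phi> n x * q x) \<in> borel_measurable lborel" for n
        using borel_measurable_integrable[OF C1c_integrable(1)[OF \<phi>(1)]] q by measurable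
      show "(\<lambda>x. indicator U x * q x) \<in> borel_measurable lborel" using borel_measurable_integrable[OF q] U
        by (intro borel_measurable_times borel_measurable_indicator) auto
      show "AE x in lborel. norm (\<phi> n x * q x) \<le> norm (q x)" for n
        using \<phi>(2,3) by (auto simp: abs_mult intro!: mult_left_le_one_le)
    qed (use q \<phi>(4) in \<open>auto intro!: tendsto_intros\<close>)
    thus ?thesis using 0[OF \<phi>(1)] by (simp add: set_lebesgue_integral_def LIMSEQ_const_iff)
  qed
  fix A :: "'a set" assume "A \<in> sets lborel"
  hence A: "A \<in> sigma_sets UNIV {S. open S}" by (simp add: borel_def)
  have b: "B \<in> sets borel" if "B \<in> sigma_sets UNIV {S. open S}" for B :: "'a set"
    using that by (simp add: borel_def)
  show "set_lebesgue_integral lborel A q = 0"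
  proof (rule sigma_sets_induct_disjoint[OF _ _ A, where P="\<lambda>A. set_lebesgue_integral lborel A q = 0"])
    show "Int_stable {S :: 'a set. open S}" by (auto simp: Int_stable_def)
    fix B :: "'a set" assume B: "B \<in> sigma_sets UNIV {S. open S}" "set_lebesgue_integral lborel B q = 0"
    have "set_lebesgue_integral lborel (B \<union> (UNIV - B)) q
      = set_lebesgue_integral lborel B q + set_lebesgue_integral lborel (UNIV - B) q"
      using b[OF B(1)] by (intro set_integral_Un si) auto
    thus "set_lebesgue_integral lborel (UNIV - B) q = 0" using B(2) op[of UNIV] by simp
  next
    fix B :: "nat \<Rightarrow> 'a set" assume B: "disjoint_family B" "range B \<subseteq> sigma_sets UNIV {S. open S}" 
      "\<And>i. set_lebesgue_integral lborel (B i) q = 0"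
    have m: "B i \<in> sets borel" for i using B(2) b by blast
    have "set_lebesgue_integral lborel (\<Union>i. B i) q = (\<Sum>i. set_lebesgue_integral lborel (B i) q)"
      by (rule lebesgue_integral_countable_add) (use B(1) m si in \<open>auto simp: disjoint_family_on_def\<close>)
    thus "set_lebesgue_integral lborel (\<Union>i. B i) q = 0" using B(3) by simp
  qed (auto simp: op)
qed

text \<open>Bounds for test functions become bounds for volumes: the cut-offs converge to the indicator of \<open>U\<close>, and
  Fatou's lemma applies.\<close>
lemma emeasure_open_le:
  fixes U :: "'a::euclidean_space set"
  assumes U: "open U"
    and le: "\<And>\<phi>. \<phi> \<in> C1c \<Longrightarrow> (\<And>x. 0 \<le> \<phi> x) \<Longrightarrow> (\<And>x. \<phi> x \<le> 1) \<Longrightarrow> supp \<phi> \<subseteq> U \<Longrightarrow> (LINT x|lborel. \<phi> x) \<le> C"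
  shows "emeasure lborel U \<le> ennreal C"
proof -
  obtain \<phi> :: "nat \<Rightarrow> 'a \<Rightarrow> real" where \<phi>: "\<And>n. \<phi> n \<in> C1c" "\<And>n x. 0 \<le> \<phi> n x" "\<And>n x. \<phi> n x \<le> 1"
    "\<And>n. supp (\<phi> n) \<subseteq> U" "\<And>x. (\<lambda>n. \<phi> n x) \<longlonglongrightarrow> indicator U x"
    using cutoffs_tendsto_indicator[OF U] by metis
  have [measurable]: "\<phi> n \<in> borel_measurable borel" for n
    using borel_measurable_integrable[OF C1c_integrable(1)[OF \<phi>(1)]] by simp
  have "emeasure lborel U = (\<integral>\<^sup>+x. liminf (\<lambda>n. ennreal (\<phi> n x)) \<partial>lborel)"
  proof -
    have "liminf (\<lambda>n. ennreal (\<phi> n x)) = indicator U x" for x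
      using lim_imp_Liminf[OF _ tendsto_ennrealI[OF \<phi>(5)[of x]]] by (auto simp: indicator_def split: if_splits)
    thus ?thesis using U by simp
  qed
  also have "\<dots> \<le> liminf (\<lambda>n. \<integral>\<^sup>+x. ennreal (\<phi> n x) \<partial>lborel)"
    by (rule nn_integral_liminf) simp
  also have "\<dots> \<le> ennreal C"
  proof (rule Liminf_le)
    show "\<forall>\<^sub>F n in sequentially. (\<integral>\<^sup>+x. ennreal (\<phi> n x) \<partial>lborel) \<le> ennreal C"
      using le[OF \<phi>(1-4)] C1c_integrable(1)[OF \<phi>(1)] \<phi>(2)
      by (auto simp: nn_integral_eq_integral intro!: ennreal_leI always_eventually)
  qed simp
  finally show ?thesis .
qed

section \<open>Differences of Sobolev functions over finite distances\<close>

lemma C1c_scaleR_integrable: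
  fixes g :: "'a::euclidean_space \<Rightarrow> 'b::euclidean_space"
  assumes \<phi>: "\<phi> \<in> C1c" and g: "integrable lborel g"
  shows "integrable lborel (\<lambda>x. \<phi> x *\<^sub>R g x)"
proof -
  obtain B where B: "\<And>x. norm (\<phi> x) \<le> B" "0 \<le> B" using C1c_bounded[OF \<phi>] by metis
  have [measurable]: "\<phi> \<in> borel_measurable borel" "g \<in> borel_measurable borel"
    using C1c_integrable(1)[OF \<phi>] g by auto
  show ?thesis
  proof (rule Bochner_Integration.integrable_bound)
    show "integrable lborel (\<lambda>x. B *\<^sub>R g x)" using g by simp
    show "AE x in lborel. norm (\<phi> x *\<^sub>R g x) \<le> norm (B *\<^sub>R g x)"
      using B by (auto intro!: AE_I2 mult_right_mono)
  qed measurable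
qed

lemma C1c_shift:
  fixes \<phi> :: "'a::euclidean_space \<Rightarrow> 'b::euclidean_space"
  assumes "\<phi> \<in> C1c" shows "(\<lambda>x. \<phi> (x - v)) \<in> C1c" "supp (\<lambda>x. \<phi> (x - v)) \<subseteq> (\<lambda>x. x + v) ` supp \<phi>"
proof -
  have c: "compact ((\<lambda>x. x + v) ` supp \<phi>)"
    using assms by (intro compact_continuous_image) (auto simp: C1c_iff intro!: continuous_intros)
  have z: "\<phi> (x - v) = 0" if "x \<notin> (\<lambda>x. x + v) ` supp \<phi>" for x
    using that by (intro supp_zero) (auto simp: image_iff)
  show "supp (\<lambda>x. \<phi> (x - v)) \<subseteq> (\<lambda>x. x + v) ` supp \<phi>"
    by (rule supp_subsetI[OF compact_imp_closed[OF c] z])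
  show "(\<lambda>x. \<phi> (x - v)) \<in> C1c"
    using assms C1_translate(1)[of \<phi> v] compact_suppI[OF c z] by (simp add: C1c_iff)
qed

lemma integral_shift_scaleR:
  fixes g :: "'a::euclidean_space \<Rightarrow> 'b::euclidean_space"
  shows "(LINT x|lborel. \<phi> (x - v) *\<^sub>R g x) = (LINT x|lborel. \<phi> x *\<^sub>R g (x + v))"
  using integral_translate(1)[of "\<lambda>x. \<phi> (x - v) *\<^sub>R g x" v] by simp

text \<open>The tested form of \<open>f (x + Z *\<^sub>R b) - f x = \<integral> D b (x + s *\<^sub>R b) ds\<close>: it is the definition of the
  weak derivative, applied to the average of \<open>\<phi>\<close> along segments. That average is supported in \<open>U\<close> because
  the segments that start in the support of \<open>\<phi>\<close> stay in \<open>U\<close>.\<close>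
lemma weak_finite_difference:
  fixes f :: "'a::euclidean_space \<Rightarrow> 'b::euclidean_space"
  assumes w: "weak_gradient U f D" and b: "b \<in> Basis" and \<phi>: "\<phi> \<in> C1c" and Z: "0 \<le> Z"
    and sub: "\<And>x s. x \<in> supp \<phi> \<Longrightarrow> 0 \<le> s \<Longrightarrow> s \<le> Z \<Longrightarrow> x + s *\<^sub>R b \<in> U"
    and f: "integrable lborel (\<lambda>x. indicator U x *\<^sub>R f x)" 
    and D: "integrable lborel (\<lambda>x. indicator U x *\<^sub>R D b x)"
  shows "(LINT x|lborel. \<phi> x *\<^sub>R (indicator U (x + Z *\<^sub>R b) *\<^sub>R f (x + Z *\<^sub>R b))) - (LINT x|lborel. \<phi> x *\<^sub>R (indicator U x *\<^sub>R f x))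
    = (LINT s|lborel. indicator {0..Z} s *\<^sub>R
        (LINT x|lborel. \<phi> x *\<^sub>R (indicator U (x + s *\<^sub>R b) *\<^sub>R D b (x + s *\<^sub>R b))))"
proof -
  have \<phi>1: "\<phi> \<in> C1" "compact (supp \<phi>)" using \<phi> by (auto simp: C1c_iff)
  have s: "supp (slide Z b \<phi>) \<subseteq> U" using supp_slide[OF \<phi>1(2), of Z b] sub by fastforce
  have p: "partial b (slide Z b \<phi>) x = \<phi> x - \<phi> (x - Z *\<^sub>R b)" for x by (rule partial_slide[OF \<phi>1(1) Z])
  have e: "(LINT x|lborel. (\<phi> x - \<phi> (x - Z *\<^sub>R b)) *\<^sub>R (indicator U x *\<^sub>R f x)) =
    - (LINT x|lborel. slide Z b \<phi> x *\<^sub>R (indicator U x *\<^sub>R D b x))"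
    using w b slide_C1c[OF \<phi>, of Z b] s
    unfolding weak_gradient_def set_lebesgue_integral_def p[symmetric] 
    by (simp add: scaleR_left_commute mult.commute)
  have "(LINT x|lborel. (\<phi> x - \<phi> (x - Z *\<^sub>R b)) *\<^sub>R (indicator U x *\<^sub>R f x)) =
    (LINT x|lborel. \<phi> x *\<^sub>R (indicator U x *\<^sub>R f x)) - (LINT x|lborel. \<phi> (x - Z *\<^sub>R b) *\<^sub>R (indicator U x *\<^sub>R f x))"
    unfolding scaleR_diff_left
    by (rule Bochner_Integration.integral_diff) (rule C1c_scaleR_integrable[OF _ f] \<phi> C1c_shift(1)[OF \<phi>])+
  with e show ?thesis
    unfolding integral_slide[OF \<phi> D] integral_shift_scaleR[of \<phi> "Z *\<^sub>R b" "\<lambda>x. indicator U x *\<^sub>R f x"]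
    by (metis (no_types, lifting) minus_diff_eq neg_equal_iff_equal)
qed

text \<open>A form of the Cauchy--Schwarz inequality for translates of \<open>g\<close>. The term with \<open>\<phi>\<close> is to be absorbed on
  the left of an estimate that uses this bound three times; the weight \<open>1 / 6\<close> leaves half of it.\<close>
lemma sliding_integral_bound:
  fixes g :: "'a::euclidean_space \<Rightarrow> 'b::euclidean_space"
  assumes \<phi>: "\<phi> \<in> C1c" "\<And>x. 0 \<le> \<phi> x" "\<And>x. \<phi> x \<le> 1" and Z: "0 \<le> Z"
    and g: "integrable lborel g" and g2: "integrable lborel (\<lambda>x. (norm (g x))\<^sup>2)"
    and D: "(LINT x|lborel. (norm (g x))\<^sup>2) \<le> D"
  shows "norm (LINT s|lborel. indicator {0..Z} s *\<^sub>R (LINT x|lborel. \<phi> x *\<^sub>R g (x + s *\<^sub>R v)))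
    \<le> Z * ((LINT x|lborel. \<phi> x) / 6 + 3 / 2 * D)"
proof -
  let ?C = "(LINT x|lborel. \<phi> x) / 6 + 3 / 2 * D"
  let ?I = "\<lambda>s. LINT x|lborel. \<phi> x *\<^sub>R g (x + s *\<^sub>R v)"
  have inner: "norm (?I s) \<le> ?C" for s
  proof -
    note i2 = integral_translate(2)[OF g2, of "s *\<^sub>R v"]
    have "norm (?I s) \<le> (LINT x|lborel. norm (\<phi> x *\<^sub>R g (x + s *\<^sub>R v)))"
      by (rule integral_norm_bound)
    also have "\<dots> \<le> (LINT x|lborel. \<phi> x / 6 + 3 / 2 * (norm (g (x + s *\<^sub>R v)))\<^sup>2)"
    proof (rule integral_mono)
      show "integrable lborel (\<lambda>x. norm (\<phi> x *\<^sub>R g (x + s *\<^sub>R v)))"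
        by (intro integrable_norm C1c_scaleR_integrable \<phi> integral_translate(2) g)
      show "integrable lborel (\<lambda>x. \<phi> x / 6 + 3 / 2 * (norm (g (x + s *\<^sub>R v)))\<^sup>2)"
        using i2 C1c_integrable(1)[OF \<phi>(1)] by simp
      fix x
      let ?a = "norm (g (x + s *\<^sub>R v))"
      \<comment> \<open>Young's inequality; of the weights with product \<open>1 / 4\<close> those with \<open>1 / 6\<close> on \<open>\<phi>\<close> are needed below.\<close>
      have "0 \<le> (3 * ?a - 1)\<^sup>2" by simp
      hence "?a \<le> 1 / 6 + 3 / 2 * ?a\<^sup>2" by (simp add: power2_eq_square algebra_simps)
      hence "\<phi> x * ?a \<le> \<phi> x * (1 / 6 + 3 / 2 * ?a\<^sup>2)" using \<phi>(2) by (rule mult_left_mono)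
      also have "\<dots> = \<phi> x / 6 + \<phi> x * (3 / 2 * ?a\<^sup>2)" by (simp add: algebra_simps)
      also have "\<dots> \<le> \<phi> x / 6 + 3 / 2 * ?a\<^sup>2" using \<phi>(2,3)[of x] by (intro add_left_mono mult_left_le_one_le) auto
      finally show "norm (\<phi> x *\<^sub>R g (x + s *\<^sub>R v)) \<le> \<phi> x / 6 + 3 / 2 * ?a\<^sup>2" using \<phi>(2) by simp
    qed
    also have "\<dots> = (LINT x|lborel. \<phi> x) / 6 + 3 / 2 * (LINT x|lborel. (norm (g (x + s *\<^sub>R v)))\<^sup>2)"
      using i2 C1c_integrable(1)[OF \<phi>(1)] by simp
    also have "\<dots> \<le> ?C" using D integral_translate(1)[of "\<lambda>x. (norm (g x))\<^sup>2" "s *\<^sub>R v"] by simp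
    finally show ?thesis .
  qed
  have C: "0 \<le> ?C" using inner[of 0] norm_ge_zero order_trans by blast
  show ?thesis
  proof (cases "integrable lborel (\<lambda>s. indicator {0..Z} s *\<^sub>R ?I s)")
    case True
    have "norm (LINT s|lborel. indicator {0..Z} s *\<^sub>R ?I s) \<le> (LINT s|lborel. norm (indicator {0..Z} s *\<^sub>R ?I s))"
      by (rule integral_norm_bound)
    also have "\<dots> \<le> (LINT s|lborel. indicator {0..Z} s * ?C)"
    proof (rule integral_mono)
      show "integrable lborel (\<lambda>s. indicator {0..Z} s * ?C)"
        by (intro integrable_mult_left integrable_real_indicator) (auto simp: emeasure_lborel_Icc_eq)
      show "norm (indicator {0..Z} s *\<^sub>R ?I s) \<le> indicator {0..Z} s * ?C" for s
        using inner[of s] by (simp add: indicator_def)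
    qed (rule integrable_norm[OF True])
    also have "\<dots> = Z * ?C" using Z by simp
    finally show ?thesis .
  qed (use C Z in \<open>simp add: not_integrable_integral_eq\<close>)
qed

section \<open>Volume controlled by the elastic energy\<close>

lemma Omega_open: "continuous_on UNIV h \<Longrightarrow> open (Omega h)"
proof -
  assume h: "continuous_on UNIV h"
  have "Omega h = {x. 0 < snd x} \<inter> {x. snd x < h (fst x)}" by (auto simp: Omega_def)
  moreover have "open {x :: space3. 0 < snd x}" by (intro open_Collect_less continuous_intros)
  moreover have "open {x. snd x < h (fst x)}"
    by (intro open_Collect_less continuous_intros continuous_on_compose2[OF h]) auto
  ultimately show ?thesis by auto
qed

text \<open>This is what makes downward averages of test functions admissible in the Gauss--Green formula that
  defines the trace: below the graph of \<open>h\<close> a vertical line meets the frontier only at the bottom.\<close>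
lemma frontier_Omega_below:
  assumes h: "continuous_on UNIV h" and "z < h p" "z' \<le> z" "0 < h p" and f: "(p, z') \<in> frontier (Omega h)"
  shows "(p, z') \<in> supp h \<times> {0}"
proof -
  have "closed {x :: space3. 0 \<le> snd x}" by (intro closed_Collect_le continuous_intros)
  hence "closure (Omega h) \<subseteq> {x. 0 \<le> snd x}" by (intro closure_minimal) (auto simp: Omega_def)
  hence "0 \<le> z'" using f by (auto simp: frontier_def)
  moreover have "\<not> 0 < z'"
  proof
    assume "0 < z'"
    hence "(p, z') \<in> Omega h" using assms by (auto simp: Omega_def)
    thus False using f Omega_open[OF h] by (auto simp: frontier_def interior_open)
  qed
  moreover have "p \<in> supp h" using assms closure_subset[of "{x. h x \<noteq> 0}"] by (auto simp: supp_def)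
  ultimately show ?thesis by auto
qed

text \<open>The tested form of the statement that \<open>u (p, z) - p\<close> is the integral of the vertical derivative from the
  bottom up to \<open>(p, z)\<close>. The Gauss--Green formula is applied to the average of \<open>\<phi>\<close> along downward segments
  of length \<open>Z\<close>. As \<open>\<phi>\<close> lives below height \<open>Z\<close>, these segments leave the domain through the bottom: the
  derivative of the average is \<open>-\<phi>\<close> inside the domain, and its trace at the bottom is the integral of
  \<open>\<phi>\<close> over the whole vertical line.\<close>
lemma trace_finite_difference:
  fixes u :: "space3 \<Rightarrow> plane"
  assumes h: "continuous_on UNIV h"
    and tr: "bottom_trace (Omega h) (supp h) u Du (\<lambda>p. p)" and \<phi>: "\<phi> \<in> C1c" and Z: "0 \<le> Z"
    and sub: "\<And>p z. (p, z) \<in> supp \<phi> \<Longrightarrow> 0 < z \<and> z < Z \<and> z < h p"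
    and u: "integrable lborel (\<lambda>x. indicator (Omega h) x *\<^sub>R u x)" 
    and D: "integrable lborel (\<lambda>x. indicator (Omega h) x *\<^sub>R Du (0, 1) x)"
  shows "(LINT x|lborel. \<phi> x *\<^sub>R (indicator (Omega h) x *\<^sub>R u x)) - (LINT x|lborel. \<phi> x *\<^sub>R fst x) =
     (LINT s|lborel. indicator {0..Z} s *\<^sub>R
        (LINT x|lborel. \<phi> x *\<^sub>R (indicator (Omega h) (x + s *\<^sub>R (0, - 1)) *\<^sub>R Du (0, 1) (x + s *\<^sub>R (0, - 1)))))"
proof -
  define k :: space3 where "k = (0, 1)"
  have k: "k \<in> Basis" by (simp add: k_def Basis_prod_def)
  have mk: "(0, - 1) = - k" by (simp add: k_def)
  have \<phi>1: "\<phi> \<in> C1" "compact (supp \<phi>)" using \<phi> by (auto simp: C1c_iff)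
  let ?\<Phi> = "slide Z (- k) \<phi>"
  have \<Phi>c: "?\<Phi> \<in> C1c" by (rule slide_C1c[OF \<phi>])
  have supp\<Phi>: "\<exists>z s. (p, z) \<in> supp \<phi> \<and> 0 \<le> s \<and> s \<le> Z \<and> z' = z - s" if "(p, z') \<in> supp ?\<Phi>" for p z'
    using supp_slide[OF \<phi>1(2), of Z "- k"] that by (fastforce simp: k_def)
  have avoid: "supp ?\<Phi> \<inter> (frontier (Omega h) - supp h \<times> {0}) = {}"
  proof -
    have "x \<in> supp h \<times> {0}" if x: "x \<in> supp ?\<Phi>" "x \<in> frontier (Omega h)" for x
    proof -
      obtain p z' where xe: "x = (p, z')" by (cases x)
      obtain z s where "(p, z) \<in> supp \<phi>" "0 \<le> s" "z' = z - s" using supp\<Phi> x(1) xe by blast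
      thus ?thesis using frontier_Omega_below[OF h, of z p z'] sub x(2) xe by fastforce
    qed
    thus ?thesis by blast
  qed
  have pk: "partial k ?\<Phi> x = \<phi> (x + Z *\<^sub>R k) - \<phi> x" for x
    using partial_slide[OF \<phi>1(1) Z, of "- k" x] partial_minus[OF slide_C1[OF \<phi>1(1)], of k Z "- k" x] by simp
  \<comment> \<open>Inside the domain one end of the vertical segment lies above height \<open>Z\<close>, outside the support.\<close>
  have up: "\<phi> (x + Z *\<^sub>R k) = 0" if "x \<in> Omega h" for x
    using that Z sub[of "fst x" "snd x + Z"] by (intro supp_zero) (cases x, auto simp: Omega_def k_def)
  have pk': "indicator (Omega h) x *\<^sub>R (partial k ?\<Phi> x *\<^sub>R u x + ?\<Phi> x *\<^sub>R Du k x) = 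
    ?\<Phi> x *\<^sub>R (indicator (Omega h) x *\<^sub>R Du k x) - \<phi> x *\<^sub>R (indicator (Omega h) x *\<^sub>R u x)" for x
    by (cases "x \<in> Omega h") (auto simp: pk up)
  have "(LINT x|lborel. ?\<Phi> x *\<^sub>R (indicator (Omega h) x *\<^sub>R Du k x) - \<phi> x *\<^sub>R (indicator (Omega h) x *\<^sub>R u x))
    = - (LINT p|lborel. indicator (supp h) p *\<^sub>R (?\<Phi> (p, 0) *\<^sub>R p))"
    using tr[unfolded bottom_trace_def, rule_format, OF \<Phi>c avoid]
    unfolding k_def[symmetric] set_lebesgue_integral_def pk' .
  also have "(LINT x|lborel. ?\<Phi> x *\<^sub>R (indicator (Omega h) x *\<^sub>R Du k x) - \<phi> x *\<^sub>R (indicator (Omega h) x *\<^sub>R u x))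
    = (LINT x|lborel. ?\<Phi> x *\<^sub>R (indicator (Omega h) x *\<^sub>R Du k x)) - (LINT x|lborel. \<phi> x *\<^sub>R (indicator (Omega h) x *\<^sub>R u x))"
    by (rule Bochner_Integration.integral_diff) (rule C1c_scaleR_integrable \<Phi>c \<phi> u D[folded k_def])+
  also have "(LINT p|lborel. indicator (supp h) p *\<^sub>R (?\<Phi> (p, 0) *\<^sub>R p)) = (LINT p|lborel. LINT z|lborel. \<phi> (p, z) *\<^sub>R p)"
  proof (rule Bochner_Integration.integral_cong[OF refl])
    fix p :: plane
    have z0: "0 \<le> z \<and> z \<le> Z" if "\<phi> (p, z) \<noteq> 0" for z
      using that sub[of p z] supp_zero[of "(p, z)" \<phi>] by fastforce
    have "p \<in> supp h" if nz: "?\<Phi> (p, 0) \<noteq> 0"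
    proof -
      have "(p, 0) \<in> supp ?\<Phi>" using nz supp_zero[of "(p, 0)" ?\<Phi>] by argo
      from supp\<Phi>[OF this] obtain z where "(p, z) \<in> supp \<phi>" by auto
      hence "h p \<noteq> 0" using sub[of p z] by auto
      thus ?thesis using supp_zero[of p h] by argo
    qed
    hence 1: "indicator (supp h) p *\<^sub>R (?\<Phi> (p, 0) *\<^sub>R p) = ?\<Phi> (p, 0) *\<^sub>R p" by (auto simp: indicator_def)
    have 2: "?\<Phi> (p, 0) = (LINT z|lborel. \<phi> (p, z))"
      unfolding slide_lebesgue[OF \<phi>1(1)]
      by (rule Bochner_Integration.integral_cong) (use z0 in \<open>auto simp: k_def indicator_def\<close>)
    have "integrable lborel (\<lambda>z. \<phi> (p, z))"
      by (rule integrable_continuous_compact_support[of _ "{0..Z}"])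
        (use z0 in \<open>auto intro!: continuous_on_compose2[OF C1_continuous[OF \<phi>1(1), of UNIV]] continuous_intros\<close>)
    hence 3: "(LINT z|lborel. \<phi> (p, z)) *\<^sub>R p = (LINT z|lborel. \<phi> (p, z) *\<^sub>R p)" by simp
    from 1 show "indicator (supp h) p *\<^sub>R (?\<Phi> (p, 0) *\<^sub>R p) = (LINT z|lborel. \<phi> (p, z) *\<^sub>R p)" unfolding 2 3 .
  qed
  also have "\<dots> = (LINT x|lborel. \<phi> x *\<^sub>R fst x)"
  proof -
    have "integrable lborel (\<lambda>x. \<phi> x *\<^sub>R fst x)"
      by (rule integrable_continuous_compact_support[OF _ \<phi>1(2)])
         (intro continuous_on_scaleR continuous_intros C1_continuous[OF \<phi>1(1)], simp add: supp_zero)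
    thus ?thesis using lborel_pair.integral_fst'[of "\<lambda>x. \<phi> x *\<^sub>R fst x"] unfolding lborel_prod by simp
  qed
  finally show ?thesis
    using integral_slide[OF \<phi>, of "\<lambda>x. indicator (Omega h) x *\<^sub>R Du k x" Z "- k"] D
    unfolding mk k_def[symmetric] by (simp add: algebra_simps)
qed

text \<open>The points of the domain below height \<open>Z\<close> from which one can move by \<open>Z\<close> in the first coordinate
  direction without leaving the domain.\<close>
definition sheltered :: "(plane \<Rightarrow> real) \<Rightarrow> real \<Rightarrow> space3 set" where
  "sheltered h Z = {(p, z). 0 < z \<and> z < Z \<and> (\<forall>s\<in>{0..Z}. z < h (p + s *\<^sub>R (1, 0)))}"

lemma sheltered_open:
  assumes h: "continuous_on UNIV h" shows "open (sheltered h Z)"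
proof -
  let ?T = "{y :: real \<times> space3. h (fst (snd y) + fst y *\<^sub>R (1, 0)) \<le> snd (snd y)}"
  have "closed ?T"
    by (intro closed_Collect_le continuous_intros continuous_on_compose2[OF h]) auto
  hence "closed {x. \<exists>s. s \<in> {0..Z} \<and> (s, x) \<in> ?T}" by (intro closed_compact_projection) auto
  moreover have "sheltered h Z = {x. 0 < snd x} \<inter> {x. snd x < Z} \<inter> - {x. \<exists>s. s \<in> {0..Z} \<and> (s, x) \<in> ?T}"
    by (auto simp: sheltered_def not_le not_less) (metis atLeastAtMost_iff not_le)
  moreover have "open {x :: space3. 0 < snd x}" "open {x :: space3. snd x < Z}"
    by (intro open_Collect_less continuous_intros)+
  ultimately show ?thesis by (simp add: open_Int open_Compl)
qed

text \<open>The heart of the lower bound. At the bottom, moving by \<open>Z\<close> in the first direction changes \<open>u\<close> by exactly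
  \<open>Z\<close>. From a sheltered point there are two ways to see this change: along the horizontal segment of
  length \<open>Z\<close>, or by going down at one end, along the bottom, and up at the other end. All three paths inside
  the domain have length at most \<open>Z\<close>. So a displacement of size \<open>Z\<close> must be produced by integrating the
  gradient over length \<open>Z\<close>, for every sheltered point; hence the gradient is of order one there in the mean
  square sense, and the energy is at least of the order of the sheltered volume. Since everything is linear
  in \<open>u\<close>, the three tested difference formulas can simply be combined.\<close>
lemma sheltered_test_bound:
  fixes u :: "space3 \<Rightarrow> plane"
  assumes h: "continuous_on UNIV h" and w: "weak_gradient (Omega h) u Du"
    and tr: "bottom_trace (Omega h) (supp h) u Du (\<lambda>p. p)" and Z: "0 < Z"
    and u: "integrable lborel (\<lambda>x. indicator (Omega h) x *\<^sub>R u x)" 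
    and D1: "\<And>b. b \<in> Basis \<Longrightarrow> integrable lborel (\<lambda>x. indicator (Omega h) x *\<^sub>R Du b x)"
    and D2: "\<And>b. b \<in> Basis \<Longrightarrow> integrable lborel (\<lambda>x. (norm (indicator (Omega h) x *\<^sub>R Du b x))\<^sup>2)"
    and D: "\<And>b. b \<in> Basis \<Longrightarrow> (LINT x|lborel. (norm (indicator (Omega h) x *\<^sub>R Du b x))\<^sup>2) \<le> D"
    and \<phi>: "\<phi> \<in> C1c" "\<And>x. 0 \<le> \<phi> x" "\<And>x. \<phi> x \<le> 1" "supp \<phi> \<subseteq> sheltered h Z"
  shows "(LINT x|lborel. \<phi> x) \<le> 9 * D"
proof -
  define e :: space3 where "e = ((1, 0), 0)"
  define k :: space3 where "k = (0, 1)"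
  have Basis: "e \<in> Basis" "k \<in> Basis" by (auto simp: e_def k_def Basis_prod_def)
  have tri: "norm (a + b - c) \<le> norm a + norm b + norm c" for a b c :: plane
    using norm_triangle_ineq4[of "a + b" c] norm_triangle_ineq[of a b] by simp
  let ?u = "\<lambda>x. indicator (Omega h) x *\<^sub>R u x"
  let ?g = "\<lambda>b x. indicator (Omega h) x *\<^sub>R Du b x"
  let ?I = "\<lambda>\<phi> v b. LINT s|lborel. indicator {0..Z} s *\<^sub>R (LINT x|lborel. \<phi> x *\<^sub>R ?g b (x + s *\<^sub>R v))"
  let ?\<phi>' = "\<lambda>x. \<phi> (x - Z *\<^sub>R e)"
  have \<phi>1: "\<phi> \<in> C1" "compact (supp \<phi>)" using \<phi> by (auto simp: C1c_iff)
  have \<phi>': "?\<phi>' \<in> C1c" by (rule C1c_shift(1)[OF \<phi>(1)])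
  have sub: "0 < z \<and> z < Z \<and> z < h (p + s *\<^sub>R (1, 0))" if "(p, z) \<in> supp \<phi>" "0 \<le> s" "s \<le> Z" for p z s
    using that \<phi>(4) by (auto simp: sheltered_def)
  have 1: "(LINT x|lborel. \<phi> x *\<^sub>R ?u (x + Z *\<^sub>R e)) - (LINT x|lborel. \<phi> x *\<^sub>R ?u x) = ?I \<phi> e e"
  proof (rule weak_finite_difference[OF w Basis(1) \<phi>(1) less_imp_le[OF Z] _ u D1[OF Basis(1)]])
    fix x s assume "x \<in> supp \<phi>" "0 \<le> s" "s \<le> Z"
    thus "x + s *\<^sub>R e \<in> Omega h"
      using sub[of "fst x" "snd x" s] by (cases x) (auto simp: Omega_def e_def)
  qed
  have 2: "(LINT x|lborel. \<phi> x *\<^sub>R ?u x) - (LINT x|lborel. \<phi> x *\<^sub>R fst x) = ?I \<phi> (0, - 1) k"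
    unfolding k_def
  proof (rule trace_finite_difference[OF h tr \<phi>(1) less_imp_le[OF Z] _ u D1[OF Basis(2)[unfolded k_def]]])
    show "0 < z \<and> z < Z \<and> z < h p" if "(p, z) \<in> supp \<phi>" for p z using sub[of p z 0] that Z by (simp flip: zero_prod_def)
  qed
  have 3: "(LINT x|lborel. ?\<phi>' x *\<^sub>R ?u x) - (LINT x|lborel. ?\<phi>' x *\<^sub>R fst x) = ?I ?\<phi>' (0, - 1) k"
    unfolding k_def
  proof (rule trace_finite_difference[OF h tr \<phi>' less_imp_le[OF Z] _ u D1[OF Basis(2)[unfolded k_def]]])
    fix p z assume "(p, z) \<in> supp ?\<phi>'"
    then obtain q where "(q, z) \<in> supp \<phi>" "p = q + Z *\<^sub>R (1, 0)"
      using C1c_shift(2)[OF \<phi>(1), of "Z *\<^sub>R e"] by (force simp: e_def)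
    thus "0 < z \<and> z < Z \<and> z < h p" using sub[of q z Z] Z by simp
  qed
  have fint: "integrable lborel (\<lambda>x. \<phi> x *\<^sub>R fst x)"
    by (rule integrable_continuous_compact_support[OF _ \<phi>1(2)])
       (intro continuous_on_scaleR continuous_intros C1_continuous[OF \<phi>1(1)], simp add: supp_zero)
  have "(LINT x|lborel. ?\<phi>' x *\<^sub>R fst x) = (LINT x|lborel. \<phi> x *\<^sub>R fst x + \<phi> x *\<^sub>R fst (Z *\<^sub>R e))"
    unfolding integral_shift_scaleR[of \<phi> "Z *\<^sub>R e" fst] by (simp add: algebra_simps)
  also have "\<dots> = (LINT x|lborel. \<phi> x *\<^sub>R fst x) + (LINT x|lborel. \<phi> x) *\<^sub>R fst (Z *\<^sub>R e)"
    using fint C1c_integrable(1)[OF \<phi>(1)] by simp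
  \<comment> \<open>The values of \<open>u\<close> at the two ends cancel; what remains are the boundary values, which differ by \<open>Z\<close>.\<close>
  finally have "(LINT x|lborel. \<phi> x) *\<^sub>R fst (Z *\<^sub>R e) = ?I \<phi> e e + ?I \<phi> (0, - 1) k - ?I ?\<phi>' (0, - 1) k"
    using 1 2 3 unfolding integral_shift_scaleR[of \<phi> "Z *\<^sub>R e" ?u] by (simp add: algebra_simps)
  hence "norm ((LINT x|lborel. \<phi> x) *\<^sub>R fst (Z *\<^sub>R e)) \<le> norm (?I \<phi> e e) + norm (?I \<phi> (0, - 1) k) + norm (?I ?\<phi>' (0, - 1) k)"
    by (simp only: tri)
  also have "\<dots> \<le> Z * ((LINT x|lborel. \<phi> x) / 6 + 3 / 2 * D) + Z * ((LINT x|lborel. \<phi> x) / 6 + 3 / 2 * D)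
      + Z * ((LINT x|lborel. ?\<phi>' x) / 6 + 3 / 2 * D)"
    by (intro add_mono sliding_integral_bound \<phi> \<phi>' less_imp_le[OF Z] D1 D2 D Basis)
  also have "(LINT x|lborel. ?\<phi>' x) = (LINT x|lborel. \<phi> x)"
    using integral_translate(1)[of \<phi> "- (Z *\<^sub>R e)"] by simp
  also have "norm ((LINT x|lborel. \<phi> x) *\<^sub>R fst (Z *\<^sub>R e)) = Z * (LINT x|lborel. \<phi> x)"
    using Z \<phi>(2) by (simp add: e_def norm_Pair abs_mult)
  finally have "Z * (LINT x|lborel. \<phi> x) \<le> Z * ((LINT x|lborel. \<phi> x) / 2 + 9 / 2 * D)" by (simp add: algebra_simps)
  thus ?thesis using Z by simp
qed

lemma sheltered_volume:
  fixes u :: "space3 \<Rightarrow> plane"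
  assumes h: "continuous_on UNIV h" and fin: "emeasure lborel (Omega h) < \<infinity>" and H1: "H1 (Omega h) u Du"
    and tr: "bottom_trace (Omega h) (supp h) u Du (\<lambda>p. p)" and Z: "0 < Z"
  shows "emeasure lborel (sheltered h Z) \<le> 9 * (\<integral>\<^sup>+x\<in>Omega h. ennreal ((grad_norm Du x)\<^sup>2) \<partial>lborel)"
proof -
  let ?O = "Omega h"
  have [measurable]: "?O \<in> sets borel" using Omega_open[OF h] by simp
  have L2_int: "integrable lborel (\<lambda>x. indicator ?O x *\<^sub>R f x)" 
    "integrable lborel (\<lambda>x. (norm (indicator ?O x *\<^sub>R f x))\<^sup>2)" if f: "f \<in> L2 ?O" for f :: "space3 \<Rightarrow> plane"
  proof -
    have m: "(\<lambda>x. indicator ?O x *\<^sub>R f x) \<in> borel_measurable lborel" 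
      and i: "integrable lborel (\<lambda>x. indicator ?O x *\<^sub>R (norm (f x))\<^sup>2)" 
      using f by (auto simp: L2_def set_borel_measurable_def set_integrable_def)
    have "(\<lambda>x. (norm (indicator ?O x *\<^sub>R f x))\<^sup>2) = (\<lambda>x. indicator ?O x *\<^sub>R (norm (f x))\<^sup>2)"
      by (auto simp: indicator_def)
    thus "integrable lborel (\<lambda>x. (norm (indicator ?O x *\<^sub>R f x))\<^sup>2)" using i by simp
    show "integrable lborel (\<lambda>x. indicator ?O x *\<^sub>R f x)"
    proof (rule Bochner_Integration.integrable_bound[OF _ m])
      show "integrable lborel (\<lambda>x. indicator ?O x + indicator ?O x *\<^sub>R (norm (f x))\<^sup>2)"
        using i fin by (intro Bochner_Integration.integrable_add integrable_real_indicator) auto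
      have "a \<le> 1 + a\<^sup>2" for a :: real
        using zero_le_power2[of "2 * a - 1"] by (simp add: power2_eq_square algebra_simps)
      thus "AE x in lborel. norm (indicator ?O x *\<^sub>R f x) \<le> norm (indicator ?O x + indicator ?O x *\<^sub>R (norm (f x))\<^sup>2)"
        by (auto simp: indicator_def)
    qed
  qed
  have Db: "Du b \<in> L2 ?O" if "b \<in> Basis" for b using H1 that by (auto simp: H1_def)
  define D where "D = (LINT x|lborel. indicator ?O x *\<^sub>R (grad_norm Du x)\<^sup>2)"
  have gn: "indicator ?O x *\<^sub>R (grad_norm Du x)\<^sup>2 = (\<Sum>b\<in>Basis. (norm (indicator ?O x *\<^sub>R Du b x))\<^sup>2)" for x
    unfolding grad_norm_def by (auto simp: indicator_def sum_nonneg)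
  have int: "integrable lborel (\<lambda>x. indicator ?O x *\<^sub>R (grad_norm Du x)\<^sup>2)"
    unfolding gn by (intro Bochner_Integration.integrable_sum L2_int Db)
  have D: "(LINT x|lborel. (norm (indicator ?O x *\<^sub>R Du b x))\<^sup>2) \<le> D" if b: "b \<in> Basis" for b
    unfolding D_def
  proof (rule integral_mono[OF L2_int(2)[OF Db[OF b]] int])
    show "(norm (indicator ?O x *\<^sub>R Du b x))\<^sup>2 \<le> indicator ?O x *\<^sub>R (grad_norm Du x)\<^sup>2" for x
      unfolding gn using b by (intro member_le_sum) auto
  qed
  have "emeasure lborel (sheltered h Z) \<le> ennreal (9 * D)"
    by (rule emeasure_open_le[OF sheltered_open[OF h]],
      rule sheltered_test_bound[OF h _ tr Z L2_int(1) L2_int(1)[OF Db] L2_int(2)[OF Db] D])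
      (use H1 in \<open>simp_all add: H1_def\<close>)
  also have "\<dots> = 9 * ennreal D" by (simp add: ennreal_mult')
  also have "ennreal D = (\<integral>\<^sup>+x. ennreal (indicator ?O x *\<^sub>R (grad_norm Du x)\<^sup>2) \<partial>lborel)"
    unfolding D_def by (rule nn_integral_eq_integral[symmetric, OF int]) auto
  also have "\<dots> = (\<integral>\<^sup>+x\<in>?O. ennreal ((grad_norm Du x)\<^sup>2) \<partial>lborel)"
    by (intro nn_integral_cong) (auto simp: indicator_def)
  finally show ?thesis .
qed

section \<open>Oscillation controlled by the surface energy\<close>

lemma AE_lborel_translate:
  fixes a :: "'a::euclidean_space"
  assumes "AE x in lborel. P x" shows "AE x in lborel. P (x + a)"
proof -
  obtain N where N: "{x \<in> space lborel. \<not> P x} \<subseteq> N" "emeasure lborel N = 0" "N \<in> sets lborel"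
    using assms by (rule AE_E)
  have [measurable]: "N \<in> sets borel" using N(3) by simp
  have "AE x in lborel. x \<notin> N" using N by (intro AE_not_in) (auto simp: null_sets_def)
  hence "AE x in distr lborel borel ((+) a). x \<notin> N" by (subst lborel_distr_plus)
  hence "AE x in lborel. a + x \<notin> N" by (subst (asm) AE_distr_iff) auto
  thus ?thesis by eventually_elim (use N(1) in \<open>auto simp: add.commute\<close>)
qed

text \<open>An upper bound for the oscillation of a function with derivative \<open>D\<close> in direction \<open>b\<close> on the segment of
  length \<open>Z\<close> that starts at \<open>x\<close>. Values in \<open>ennreal\<close> leave room for the null set where it is infinite.\<close>
definition line_variation :: "real \<Rightarrow> 'a::euclidean_space \<Rightarrow> ('a \<Rightarrow> real) \<Rightarrow> 'a \<Rightarrow> ennreal" where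
  "line_variation Z b D x = (\<integral>\<^sup>+s. indicator {0..Z} s * ennreal \<bar>D (x + s *\<^sub>R b)\<bar> \<partial>lborel)"

lemma line_variation_measurable [measurable]:
  assumes [measurable]: "D \<in> borel_measurable borel"
  shows "line_variation Z b D \<in> borel_measurable borel"
  unfolding line_variation_def[abs_def] by measurable

lemma nn_integral_line_variation:
  assumes [measurable]: "D \<in> borel_measurable borel" and Z: "0 \<le> Z"
  shows "(\<integral>\<^sup>+x. line_variation Z b D x \<partial>lborel) = ennreal Z * (\<integral>\<^sup>+x. ennreal \<bar>D x\<bar> \<partial>lborel)"
proof -
  have "(\<integral>\<^sup>+x. line_variation Z b D x \<partial>lborel) =
    (\<integral>\<^sup>+s. \<integral>\<^sup>+x. indicator {0..Z} s * ennreal \<bar>D (x + s *\<^sub>R b)\<bar> \<partial>lborel \<partial>lborel)"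
    unfolding line_variation_def by (rule lborel_pair.Fubini') measurable
  also have "\<dots> = (\<integral>\<^sup>+s. indicator {0..Z} s * (\<integral>\<^sup>+x. ennreal \<bar>D (x + s *\<^sub>R b)\<bar> \<partial>lborel) \<partial>lborel)"
    by (subst nn_integral_cmult) auto
  also have "\<dots> = (\<integral>\<^sup>+s. indicator {0..Z} s * (\<integral>\<^sup>+x. ennreal \<bar>D x\<bar> \<partial>lborel) \<partial>lborel)"
    by (subst nn_integral_translate[where g="\<lambda>x. ennreal \<bar>D x\<bar>"]) auto
  also have "\<dots> = ennreal Z * (\<integral>\<^sup>+x. ennreal \<bar>D x\<bar> \<partial>lborel)"
    using Z by (subst nn_integral_multc) auto
  finally show ?thesis .
qed

lemma line_variation_bound_single:
  fixes f :: "'a::euclidean_space \<Rightarrow> real"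
  assumes f: "integrable lborel f" and w: "weak_gradient UNIV f D" and b: "b \<in> Basis"
    and D: "integrable lborel (D b)" and nonneg: "\<And>x. 0 \<le> f x" and s: "0 \<le> s" "s \<le> Z"
  shows "AE x in lborel. ennreal (f x) \<le> ennreal (f (x + s *\<^sub>R b)) + line_variation Z b (D b) x"
proof -
  have [measurable]: "D b \<in> borel_measurable borel" using D by auto
  let ?F = "\<lambda>r x. indicator {0..s} r *\<^sub>R D b (x + r *\<^sub>R b)"
  let ?A = "\<lambda>x. LINT r|lborel. ?F r x"
  have int: "integrable (lborel \<Otimes>\<^sub>M lborel) (\<lambda>(r, x). ?F r x)" by (rule integrable_slide[OF D])
  have A: "integrable lborel ?A" using lborel_pair.integrable_snd[OF int] by simp
  have fs: "integrable lborel (\<lambda>x. f (x + s *\<^sub>R b))" by (rule integral_translate(2)[OF f])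
  have "AE x in lborel. f x - f (x + s *\<^sub>R b) + ?A x = 0"
  proof (rule fundamental_lemma_of_variations)
    show "integrable lborel (\<lambda>x. f x - f (x + s *\<^sub>R b) + ?A x)" using f fs A by simp
    fix \<phi> :: "'a \<Rightarrow> real" assume \<phi>: "\<phi> \<in> C1c"
    have [measurable]: "\<phi> \<in> borel_measurable borel" using C1c_integrable(1)[OF \<phi>] by auto
    obtain B where B: "\<And>x. norm (\<phi> x) \<le> B" "0 \<le> B" using C1c_bounded[OF \<phi>] by metis
    have int': "integrable (lborel \<Otimes>\<^sub>M lborel) (\<lambda>(r, x). \<phi> x * ?F r x)"
    proof (rule Bochner_Integration.integrable_bound)
      show "integrable (lborel \<Otimes>\<^sub>M lborel) (\<lambda>(r, x). B * ?F r x)"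
        using integrable_mult_right[OF int, of B] by (simp add: case_prod_unfold)
      show "AE p in lborel \<Otimes>\<^sub>M lborel. norm (case p of (r, x) \<Rightarrow> \<phi> x * ?F r x) \<le> norm (case p of (r, x) \<Rightarrow> B * ?F r x)"
        using B by (auto simp: abs_mult intro!: AE_I2 mult_right_mono)
    qed measurable
    have "(LINT x|lborel. \<phi> x * ?A x) = (LINT x|lborel. LINT r|lborel. \<phi> x * ?F r x)" by simp
    also have "\<dots> = (LINT r|lborel. LINT x|lborel. \<phi> x * ?F r x)"
      using lborel_pair.Fubini_integral[OF int'] by simp
    also have "\<dots> = (LINT r|lborel. indicator {0..s} r *\<^sub>R (LINT x|lborel. \<phi> x *\<^sub>R D b (x + r *\<^sub>R b)))"
      by (intro Bochner_Integration.integral_cong refl) (auto simp: indicator_def)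
    also have "\<dots> = (LINT x|lborel. \<phi> x *\<^sub>R f (x + s *\<^sub>R b)) - (LINT x|lborel. \<phi> x *\<^sub>R f x)"
      using weak_finite_difference[OF w b \<phi> s(1)] f D by simp
    finally show "(LINT x|lborel. \<phi> x * (f x - f (x + s *\<^sub>R b) + ?A x)) = 0"
      using C1c_scaleR_integrable[OF \<phi> f] C1c_scaleR_integrable[OF \<phi> fs] C1c_scaleR_integrable[OF \<phi> A]
      by (simp add: algebra_simps)
  qed
  thus ?thesis
  proof eventually_elim
    case (elim x)
    have "ennreal \<bar>?A x\<bar> \<le> (\<integral>\<^sup>+r. ennreal (norm (?F r x)) \<partial>lborel)"
      using integral_norm_bound_ennreal[of lborel "\<lambda>r. ?F r x"]
      by (cases "integrable lborel (\<lambda>r. ?F r x)") (auto simp: not_integrable_integral_eq)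
    also have "\<dots> \<le> line_variation Z b (D b) x"
      unfolding line_variation_def using s by (intro nn_integral_mono) (auto simp: indicator_def)
    finally have le: "ennreal \<bar>?A x\<bar> \<le> line_variation Z b (D b) x" .
    have "ennreal (f x) \<le> ennreal (f (x + s *\<^sub>R b) + \<bar>?A x\<bar>)" using elim by (intro ennreal_leI) linarith
    also have "\<dots> \<le> ennreal (f (x + s *\<^sub>R b)) + ennreal \<bar>?A x\<bar>" using nonneg by (simp add: ennreal_plus)
    also have "\<dots> \<le> ennreal (f (x + s *\<^sub>R b)) + line_variation Z b (D b) x" using le by (intro add_left_mono)
    finally show ?case .
  qed
qed

text \<open>For a single \<open>s\<close> this is the difference formula, made pointwise by the fundamental lemma. The exceptional
  null set depends on \<open>s\<close>; it can be chosen uniformly for rational \<open>s\<close>, and continuity of \<open>f\<close> covers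
  the remaining ones.\<close>
lemma line_variation_bound:
  fixes f :: "'a::euclidean_space \<Rightarrow> real"
  assumes f: "integrable lborel f" and w: "weak_gradient UNIV f D" and b: "b \<in> Basis"
    and D: "integrable lborel (D b)" and Z: "0 < Z" and c: "continuous_on UNIV f" and nonneg: "\<And>x. 0 \<le> f x"
  shows "AE x in lborel. \<forall>s\<in>{0..Z}. ennreal (f x) \<le> ennreal (f (x + s *\<^sub>R b)) + line_variation Z b (D b) x"
proof -
  let ?J = "line_variation Z b (D b)"
  have "AE x in lborel. \<forall>s\<in>{0<..<Z} \<inter> \<rat>. ennreal (f x) \<le> ennreal (f (x + s *\<^sub>R b)) + ?J x"
    by (subst AE_ball_countable) (auto intro!: line_variation_bound_single[OF f w b D nonneg] countable_Int2 countable_rat)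
  thus ?thesis
  proof eventually_elim
    case (elim x)
    show ?case
    proof (cases "?J x")
      case (real j)
      have "ennreal (f x) \<le> ennreal (f (x + s *\<^sub>R b)) + ?J x" if s: "s \<in> {0..Z}" for s
      proof -
        have "closure ({0<..<Z} \<inter> \<rat>) = closure {0<..<Z}" 
          by (intro closure_open_Int_superset) (auto simp: Rats_closure_real)
        hence "s \<in> closure ({0<..<Z} \<inter> \<rat>)" using s Z by simp
        hence "f x - j \<le> f (x + s *\<^sub>R b)"
        proof (rule continuous_ge_on_closure[rotated])
          fix r assume "r \<in> {0<..<Z} \<inter> \<rat>"
          hence "ennreal (f x) \<le> ennreal (f (x + r *\<^sub>R b)) + ?J x" using elim by blast
          thus "f x - j \<le> f (x + r *\<^sub>R b)" using real nonneg by (simp flip: ennreal_plus)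
        qed (auto intro!: continuous_on_compose2[OF c] continuous_intros)
        thus ?thesis using real nonneg by (simp flip: ennreal_plus)
      qed
      thus ?thesis by blast
    qed auto
  qed
qed

lemma ennreal_diff_le: "ennreal a \<le> b + c \<Longrightarrow> ennreal a - c \<le> b"
  by (auto simp: ennreal_minus_le_iff add.commute)

section \<open>The lower bound\<close>

text \<open>If \<open>h p\<close> exceeds \<open>z\<close> by more than the variation of \<open>h\<close> along the segment, then the segment at height
  \<open>z\<close> stays below the graph.\<close>
lemma sheltered_volume_ge:
  fixes h :: "plane \<Rightarrow> real"
  assumes c: "continuous_on UNIV h" and nonneg: "\<And>p. 0 \<le> h p" and h: "integrable lborel h"
    and w: "weak_gradient UNIV h Dh"
    and D: "integrable lborel (Dh (1, 0))" and Z: "0 < Z"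
  shows "(\<integral>\<^sup>+p. min (ennreal (h p) - line_variation Z (1, 0) (Dh (1, 0)) p) (ennreal Z) \<partial>lborel)
    \<le> emeasure lborel (sheltered h Z)"
proof -
  let ?J = "line_variation Z (1, 0) (Dh (1, 0))"
  have b: "(1, 0) \<in> (Basis :: plane set)" by (simp add: Basis_prod_def)
  have o: "open (sheltered h Z)" by (rule sheltered_open[OF c])
  have "(\<integral>\<^sup>+p. min (ennreal (h p) - ?J p) (ennreal Z) \<partial>lborel)
    \<le> (\<integral>\<^sup>+p. emeasure lborel (Pair p -` sheltered h Z) \<partial>lborel)"
  proof (rule nn_integral_mono_AE)
    show "AE p in lborel. min (ennreal (h p) - ?J p) (ennreal Z) \<le> emeasure lborel (Pair p -` sheltered h Z)"
      using line_variation_bound[OF h w b D Z c nonneg]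
    proof eventually_elim
      case (elim p)
      \<comment> \<open>The vertical section of the sheltered set over \<open>p\<close> contains an interval of this length.\<close>
      define r where "r = enn2real (min (ennreal (h p) - ?J p) (ennreal Z))"
      have r: "ennreal r = min (ennreal (h p) - ?J p) (ennreal Z)" 
        unfolding r_def by (rule ennreal_enn2real) (simp add: min_less_iff_disj)
      have "{0<..<r} \<subseteq> Pair p -` sheltered h Z"
      proof
        fix z assume z: "z \<in> {0<..<r}"
        hence zr: "ennreal z < ennreal r" by (simp add: ennreal_less_iff)
        hence "z < Z" using z Z unfolding r by (simp add: ennreal_less_iff)
        moreover have "z < h (p + s *\<^sub>R (1, 0))" if "s \<in> {0..Z}" for s
        proof -
          have "ennreal z < ennreal (h p) - ?J p" using zr unfolding r by simp
          also have "\<dots> \<le> ennreal (h (p + s *\<^sub>R (1, 0)))" using elim that by (intro ennreal_diff_le) blast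
          finally show ?thesis using z by (simp add: ennreal_less_iff)
        qed
        ultimately show "z \<in> Pair p -` sheltered h Z" using z by (simp add: sheltered_def)
      qed
      hence "emeasure lborel {0<..<r} \<le> emeasure lborel (Pair p -` sheltered h Z)"
        using o by (intro emeasure_mono) (auto intro!: borel_open open_vimage continuous_intros)
      moreover have "emeasure lborel {0<..<r} = ennreal r" by (simp add: r_def)
      ultimately show ?case using r by simp
    qed
  qed
  also have "\<dots> = emeasure lborel (sheltered h Z)"
  proof -
    have "sheltered h Z \<in> sets (lborel \<Otimes>\<^sub>M lborel)" unfolding lborel_prod using o by simp
    from lborel.emeasure_pair_measure_alt[OF this] show ?thesis unfolding lborel_prod by simp
  qed
  finally show ?thesis .
qed

text \<open>A substitute for the isoperimetric inequality, obtained by averaging over translations. Let \<open>F\<close> be the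
  volume above level \<open>Z\<close>, and \<open>A\<close> the set where \<open>n\<close> exceeds \<open>Z\<close>. A translation by \<open>t\<close> in the square
  \<open>[0, Z]\<^sup>2\<close> lowers \<open>h\<close> by at most \<open>2 * Z * T\<close> in total, and replacing \<open>h\<close> by \<open>n\<close> costs another
  \<open>Z * T\<close>; so up to \<open>3 * Z * T\<close> all of the volume \<open>F\<close> sits over points \<open>p\<close> with \<open>p + t\<close> in \<open>A\<close>.
  Integration over \<open>t\<close> gives the factor \<open>Z\<^sup>2\<close> on the left, while on the right each \<open>p\<close> contributes at most
  the area of \<open>A\<close>. If \<open>Z * T\<close> is small compared with \<open>F\<close>, then \<open>A\<close> has area of order at least \<open>Z\<^sup>2\<close>.\<close>
lemma volume_above_level_bound:
  fixes h :: "plane \<Rightarrow> real"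
  assumes h: "integrable lborel h" and nonneg: "\<And>p. 0 \<le> h p" and c: "continuous_on UNIV h"
    and w: "weak_gradient UNIV h Dh" and Z: "0 < Z"
    and D: "\<And>b. b \<in> Basis \<Longrightarrow> integrable lborel (Dh b)"
    and T: "\<And>b. b \<in> Basis \<Longrightarrow> (\<integral>\<^sup>+p. ennreal \<bar>Dh b p\<bar> \<partial>lborel) \<le> T"
  defines "n \<equiv> \<lambda>p. ennreal (h p) - line_variation Z (1, 0) (Dh (1, 0)) p"
  shows "ennreal (Z\<^sup>2) * (\<integral>\<^sup>+p. ennreal (h p) - ennreal Z \<partial>lborel) \<le>
    (\<integral>\<^sup>+p. ennreal (h p) - ennreal Z \<partial>lborel) * emeasure lborel {p. ennreal Z < n p}
    + ennreal (Z\<^sup>2) * (3 * (ennreal Z * T))"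
proof -
  let ?e1 = "(1, 0) :: plane" and ?e2 = "(0, 1) :: plane"
  have b: "?e1 \<in> Basis" "?e2 \<in> Basis" by (auto simp: Basis_prod_def)
  let ?J1 = "line_variation Z ?e1 (Dh ?e1)" and ?J2 = "line_variation Z ?e2 (Dh ?e2)"
  let ?f0 = "\<lambda>p. ennreal (h p) - ennreal Z"
  let ?A = "{p. ennreal Z < n p}"
  have [measurable]: "h \<in> borel_measurable borel" "Dh ?e1 \<in> borel_measurable borel" "Dh ?e2 \<in> borel_measurable borel"
    using h D[OF b(1)] D[OF b(2)] by auto
  have [measurable]: "?A \<in> sets borel" unfolding n_def by measurable
  have J: "(\<integral>\<^sup>+p. ?J1 (p + a) \<partial>lborel) \<le> ennreal Z * T" "(\<integral>\<^sup>+p. ?J2 (p + a) \<partial>lborel) \<le> ennreal Z * T" for a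
    using T[OF b(1)] T[OF b(2)] Z
    by (auto simp: nn_integral_translate nn_integral_line_variation intro!: mult_left_mono)
  note v1 = line_variation_bound[OF h w b(1) D[OF b(1)] Z c nonneg]
  note v2 = line_variation_bound[OF h w b(2) D[OF b(2)] Z c nonneg]
  have shift: "(\<integral>\<^sup>+p. ?f0 p \<partial>lborel) \<le> (\<integral>\<^sup>+p. ?f0 p * indicator ?A (p + t) \<partial>lborel) + 3 * (ennreal Z * T)"
    if t: "t \<in> {0..Z} \<times> {0..Z}" for t
  proof -
    obtain t1 t2 where te: "t = (t1, t2)" by (cases t)
    have t12: "t1 \<in> {0..Z}" "t2 \<in> {0..Z}" using t te by auto
    have tt: "p + t1 *\<^sub>R ?e1 + t2 *\<^sub>R ?e2 = p + t" for p by (cases p) (simp add: te)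
    \<comment> \<open>Go from \<open>p\<close> to \<open>p + t\<close> along the two sides of a rectangle, and then from \<open>h\<close> to \<open>n\<close>.\<close>
    have "AE p in lborel. ?f0 p \<le> ?f0 p * indicator ?A (p + t) + (?J1 p + ?J2 (p + t1 *\<^sub>R ?e1) + ?J1 (p + t))"
      using v1 AE_lborel_translate[OF v2, of "t1 *\<^sub>R ?e1"]
    proof eventually_elim
      case (elim p)
      show ?case
      proof (cases "p + t \<in> ?A")
        case False
        have "ennreal (h (p + t)) \<le> ennreal Z + ?J1 (p + t)"
          using False unfolding n_def by (simp add: not_less ennreal_minus_le_iff) (metis add.commute top_greatest)
        have "ennreal (h p) \<le> ennreal (h (p + t1 *\<^sub>R ?e1)) + ?J1 p" using elim(1) t12 by blast
        also have "\<dots> \<le> ennreal (h (p + t)) + ?J2 (p + t1 *\<^sub>R ?e1) + ?J1 p" 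
          using elim(2) t12(2) unfolding tt[symmetric] by (intro add_right_mono) blast
        also have "\<dots> \<le> ennreal Z + ?J1 (p + t) + ?J2 (p + t1 *\<^sub>R ?e1) + ?J1 p"
          by (intro add_right_mono) fact
        finally have "ennreal (h p) \<le> (?J1 p + ?J2 (p + t1 *\<^sub>R ?e1) + ?J1 (p + t)) + ennreal Z" by (simp add: ac_simps)
        hence "?f0 p \<le> ?J1 p + ?J2 (p + t1 *\<^sub>R ?e1) + ?J1 (p + t)" by (rule ennreal_diff_le)
        thus ?thesis using False by simp
      qed simp
    qed
    hence "(\<integral>\<^sup>+p. ?f0 p \<partial>lborel) \<le> 
      (\<integral>\<^sup>+p. ?f0 p * indicator ?A (p + t) + (?J1 p + ?J2 (p + t1 *\<^sub>R ?e1) + ?J1 (p + t)) \<partial>lborel)"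
      by (rule nn_integral_mono_AE)
    also have "\<dots> = (\<integral>\<^sup>+p. ?f0 p * indicator ?A (p + t) \<partial>lborel) +
      ((\<integral>\<^sup>+p. ?J1 p \<partial>lborel) + (\<integral>\<^sup>+p. ?J2 (p + t1 *\<^sub>R ?e1) \<partial>lborel) + (\<integral>\<^sup>+p. ?J1 (p + t) \<partial>lborel))"
      by (simp add: nn_integral_add)
    also have "\<dots> \<le> (\<integral>\<^sup>+p. ?f0 p * indicator ?A (p + t) \<partial>lborel) + (ennreal Z * T + ennreal Z * T + ennreal Z * T)"
      using J[of t] J(2)[of "t1 *\<^sub>R ?e1"] J(1)[of 0] by (intro add_left_mono add_mono) simp_all
    also have "ennreal Z * T + ennreal Z * T + ennreal Z * T = 3 * (ennreal Z * T)"
    proof -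
      have "3 * x = (1 + 1 + 1) * x" for x :: ennreal by simp
      thus ?thesis by (simp only: distrib_right mult_1_left)
    qed
    finally show ?thesis .
  qed
  let ?Q = "{0..Z} \<times> {0..Z}"
  have Q: "emeasure lborel ?Q = ennreal (Z\<^sup>2)" 
  proof -
    have "emeasure (lborel \<Otimes>\<^sub>M lborel) ?Q = emeasure lborel {0..Z} * emeasure lborel {0..Z}"
      by (rule lborel.emeasure_pair_measure_Times) auto
    thus ?thesis using Z by (simp add: lborel_prod power2_eq_square ennreal_mult)
  qed
  have Qm[measurable]: "?Q \<in> sets borel" by (intro borel_closed closed_Times) auto
  have "ennreal (Z\<^sup>2) * (\<integral>\<^sup>+p. ?f0 p \<partial>lborel) = (\<integral>\<^sup>+t. indicator ?Q t * (\<integral>\<^sup>+p. ?f0 p \<partial>lborel) \<partial>lborel)"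
    using Q by (subst nn_integral_multc) auto
  also have "\<dots> \<le> (\<integral>\<^sup>+t. (\<integral>\<^sup>+p. ?f0 p * indicator ?A (p + t) \<partial>lborel) + indicator ?Q t * (3 * (ennreal Z * T)) \<partial>lborel)"
    using shift by (intro nn_integral_mono) (auto simp: indicator_def)
  also have "\<dots> = (\<integral>\<^sup>+t. \<integral>\<^sup>+p. ?f0 p * indicator ?A (p + t) \<partial>lborel \<partial>lborel) + ennreal (Z\<^sup>2) * (3 * (ennreal Z * T))"
    using Q by (subst nn_integral_add) (auto simp: nn_integral_multc)
  also have "(\<integral>\<^sup>+t. \<integral>\<^sup>+p. ?f0 p * indicator ?A (p + t) \<partial>lborel \<partial>lborel)
    = (\<integral>\<^sup>+p. \<integral>\<^sup>+t. ?f0 p * indicator ?A (p + t) \<partial>lborel \<partial>lborel)"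
    by (rule lborel_pair.Fubini') measurable
  also have "\<dots> = (\<integral>\<^sup>+p. ?f0 p * emeasure lborel ?A \<partial>lborel)"
  proof (rule nn_integral_cong)
    fix p
    have "(\<integral>\<^sup>+t. indicator ?A (t + p) \<partial>lborel) = emeasure lborel ?A"
      by (subst nn_integral_translate[where g="indicator ?A"]) auto
    thus "(\<integral>\<^sup>+t. ?f0 p * indicator ?A (p + t) \<partial>lborel) = ?f0 p * emeasure lborel ?A"
      by (subst nn_integral_cmult) (auto simp: add.commute)
  qed
  also have "\<dots> = (\<integral>\<^sup>+p. ?f0 p \<partial>lborel) * emeasure lborel ?A" by (rule nn_integral_multc) measurable
  finally show ?thesis .
qed

lemma abs_le_grad_norm:
  fixes D :: "'a::euclidean_space \<Rightarrow> 'a \<Rightarrow> real"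
  assumes "b \<in> Basis" shows "\<bar>D b p\<bar> \<le> grad_norm D p"
proof -
  have "(norm (D b p))\<^sup>2 \<le> (\<Sum>b\<in>Basis. (norm (D b p))\<^sup>2)" using assms by (intro member_le_sum) auto
  hence "sqrt ((norm (D b p))\<^sup>2) \<le> grad_norm D p" unfolding grad_norm_def by (rule real_sqrt_le_mono)
  thus ?thesis by simp
qed

lemma emeasure_Omega:
  assumes h: "continuous_on UNIV h" "\<And>p. 0 \<le> h p"
  shows "emeasure lborel (Omega h) = (\<integral>\<^sup>+p. ennreal (h p) \<partial>lborel)"
proof -
  have o: "Omega h \<in> sets (lborel \<Otimes>\<^sub>M lborel)" unfolding lborel_prod using Omega_open[OF h(1)] by simp
  have "emeasure lborel (Omega h) = (\<integral>\<^sup>+p. emeasure lborel (Pair p -` Omega h) \<partial>lborel)"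
    using lborel.emeasure_pair_measure_alt[OF o] unfolding lborel_prod .
  also have "\<dots> = (\<integral>\<^sup>+p. ennreal (h p) \<partial>lborel)"
  proof (rule nn_integral_cong)
    fix p have "Pair p -` Omega h = {0<..<h p}" by (auto simp: Omega_def)
    thus "emeasure lborel (Pair p -` Omega h) = ennreal (h p)" using h(2) by simp
  qed
  finally show ?thesis .
qed

text \<open>Suppose that the surface energy is so small that \<open>h\<close> varies little, compared with \<open>V\<close>, over the
  distance \<open>Z\<close>. If at least half of the volume lies below level \<open>Z\<close>, then most of it is sheltered and the
  elastic energy is of order \<open>V\<close>. Otherwise the set \<open>A\<close> of points over which the column up to height
  \<open>Z\<close> is sheltered has area of order \<open>Z\<^sup>2\<close>, and the elastic energy is of order \<open>Z ^ 3\<close>.\<close>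
lemma energy_dichotomy:
  fixes u :: "space3 \<Rightarrow> plane" and h :: "plane \<Rightarrow> real" and Du :: "space3 \<Rightarrow> space3 \<Rightarrow> plane"
  defines "E \<equiv> \<integral>\<^sup>+x\<in>Omega h. ennreal ((grad_norm Du x)\<^sup>2) \<partial>lborel"
  assumes adm: "(h, Dh, u, Du) \<in> admissible V" and V: "0 < V" and Z: "0 < Z"
    and T: "ennreal Z * (\<integral>\<^sup>+p. ennreal (grad_norm Dh p) \<partial>lborel) \<le> ennreal (V / 12)"
  shows "ennreal (V / 48) \<le> E \<or> ennreal (Z ^ 3 / 48) \<le> E"
proof -
  define Tn where "Tn = (\<integral>\<^sup>+p. ennreal (grad_norm Dh p) \<partial>lborel)"
  have h: "integrable lborel h" "weak_gradient UNIV h Dh" "continuous_on UNIV h" "\<And>p. 0 \<le> h p"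
    "(LINT p|lborel. h p) = V" and H1: "H1 (Omega h) u Du" 
    and tr: "bottom_trace (Omega h) (supp h) u Du (\<lambda>p. p)"
    and Linf: "\<And>b. b \<in> Basis \<Longrightarrow> Dh b \<in> Linf UNIV"
    using adm by (auto simp: admissible_def BV_def W1inf_def)
  have Dm: "Dh b \<in> borel_measurable borel" if "b \<in> Basis" for b
    using Linf[OF that] by (simp add: Linf_def set_borel_measurable_def)
  have Tb: "(\<integral>\<^sup>+p. ennreal \<bar>Dh b p\<bar> \<partial>lborel) \<le> Tn" if "b \<in> Basis" for b
    unfolding Tn_def by (intro nn_integral_mono ennreal_leI abs_le_grad_norm that)
  have Tfin: "Tn < \<infinity>" using T Z unfolding Tn_def[symmetric]
    by (metis ennreal_less_top ennreal_mult_eq_top_iff infinity_ennreal_def less_top not_less ennreal_eq_0_iff linorder_not_le top.extremum_unique)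
  have Dint: "integrable lborel (Dh b)" if "b \<in> Basis" for b
    using Dm[OF that] Tb[OF that] Tfin by (intro integrableI_bounded) auto
  have hV: "(\<integral>\<^sup>+p. ennreal (h p) \<partial>lborel) = ennreal V"
    using nn_integral_eq_integral[OF h(1)] h(4,5) by simp
  have [measurable]: "h \<in> borel_measurable borel" using h(1) by auto
  let ?e1 = "(1, 0) :: plane"
  have e1: "?e1 \<in> Basis" by (simp add: Basis_prod_def)
  let ?J = "line_variation Z ?e1 (Dh ?e1)"
  let ?n = "\<lambda>p. ennreal (h p) - ?J p"
  have [measurable]: "Dh ?e1 \<in> borel_measurable borel" by (rule Dm[OF e1])
  have J: "(\<integral>\<^sup>+p. ?J p \<partial>lborel) \<le> ennreal (V / 12)"
    unfolding nn_integral_line_variation[OF Dm[OF e1] less_imp_le[OF Z]]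
    by (rule order_trans[OF mult_left_mono[OF Tb[OF e1]] T[folded Tn_def]]) simp
  have vol: "emeasure lborel (Omega h) = ennreal V" using emeasure_Omega[OF h(3,4)] hV by simp
  have main: "(\<integral>\<^sup>+p. min (?n p) (ennreal Z) \<partial>lborel) \<le> 9 * E"
    unfolding E_def
    by (rule order_trans[OF sheltered_volume_ge[OF h(3,4,1,2) Dint[OF e1] Z] sheltered_volume[OF h(3) _ H1 tr Z]])
      (simp add: vol)
  define F where "F = (\<integral>\<^sup>+p. ennreal (h p) - ennreal Z \<partial>lborel)"
  \<comment> \<open>Split \<open>h\<close> at level \<open>Z\<close>, and the part below into a sheltered part and the variation of \<open>h\<close>.\<close>
  have le: "ennreal (h p) \<le> min (?n p) (ennreal Z) + ?J p + (ennreal (h p) - ennreal Z)" for p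
  proof -
    have 1: "ennreal (h p) \<le> ?n p + ?J p" 
      using ennreal_minus_le_iff[of "ennreal (h p)" "?J p" "?n p"] by (simp add: add.commute)
    have 2: "ennreal (h p) \<le> ennreal Z + (ennreal (h p) - ennreal Z)"
      by (metis ennreal_minus_le_iff order_refl)
    show ?thesis using 1 2 by (auto simp: min_def ac_simps intro: order_trans add_increasing add_increasing2)
  qed
  have "ennreal V \<le> (\<integral>\<^sup>+p. min (?n p) (ennreal Z) + ?J p + (ennreal (h p) - ennreal Z) \<partial>lborel)"
    unfolding hV[symmetric] by (intro nn_integral_mono le)
  also have "\<dots> = (\<integral>\<^sup>+p. min (?n p) (ennreal Z) \<partial>lborel) + (\<integral>\<^sup>+p. ?J p \<partial>lborel) + F"
    unfolding F_def by (simp add: nn_integral_add)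
  also have "\<dots> \<le> 9 * E + ennreal (V / 12) + F" using main J by (intro add_mono) auto
  finally have split: "ennreal V \<le> 9 * E + ennreal (V / 12) + F" .
  have "F \<le> ennreal V" unfolding F_def hV[symmetric] by (intro nn_integral_mono) (simp add: ennreal_minus_le_iff)
  then obtain f where f: "F = ennreal f" "0 \<le> f" by (metis ennreal_cases ennreal_less_top not_le top.not_eq_extremum)
  show ?thesis
  proof (cases "E")
    case (real d)
    define A where "A = {p. ennreal Z < ?n p}"
    have [measurable]: "A \<in> sets borel" unfolding A_def by measurable
    have "ennreal Z * emeasure lborel A = (\<integral>\<^sup>+p. ennreal Z * indicator A p \<partial>lborel)"
      by (simp add: nn_integral_cmult)
    also have "\<dots> \<le> (\<integral>\<^sup>+p. min (?n p) (ennreal Z) \<partial>lborel)"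
      by (intro nn_integral_mono) (auto simp: A_def indicator_def)
    finally have ZA: "ennreal Z * emeasure lborel A \<le> 9 * E" using main by simp
    also have "\<dots> = ennreal (9 * d)" using real by (simp add: ennreal_mult')
    finally have ZA: "ennreal Z * emeasure lborel A \<le> ennreal (9 * d)" .
    have "ennreal (Z\<^sup>2) * F \<le> F * emeasure lborel A + ennreal (Z\<^sup>2) * (3 * (ennreal Z * Tn))"
      using volume_above_level_bound[OF h(1,4,3,2) Z Dint Tb] unfolding F_def A_def by simp
    also have "\<dots> \<le> F * emeasure lborel A + ennreal (Z\<^sup>2) * (3 * ennreal (V / 12))"
      using T unfolding Tn_def[symmetric] by (intro add_left_mono mult_left_mono) auto
    finally have "ennreal Z * (ennreal (Z\<^sup>2) * F) \<le> ennreal Z * (F * emeasure lborel A + ennreal (Z\<^sup>2) * (3 * ennreal (V / 12)))"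
      by (rule mult_left_mono) simp
    also have "\<dots> = F * (ennreal Z * emeasure lborel A) + ennreal (Z ^ 3 * (V / 4))"
    proof -
      have "3 * ennreal (V / 12) = ennreal (V / 4)" using V ennreal_mult'[of 3 "V / 12"] by simp
      thus ?thesis using Z V by (simp add: distrib_left ennreal_mult power3_eq_cube power2_eq_square ac_simps flip: ennreal_mult)
    qed
    also have "\<dots> \<le> F * ennreal (9 * d) + ennreal (Z ^ 3 * (V / 4))"
      using ZA by (intro add_right_mono mult_left_mono) auto
    finally have "ennreal (Z ^ 3 * f) \<le> ennreal (9 * d * f + Z ^ 3 * (V / 4))"
      using f real Z V
      by (simp add: ennreal_mult power3_eq_cube power2_eq_square ac_simps flip: ennreal_mult ennreal_plus)
    \<comment> \<open>In the real variables \<open>f\<close> (volume above level \<open>Z\<close>) and \<open>d\<close> (elastic energy) two inequalities are left.\<close>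
    hence key: "Z ^ 3 * f \<le> 9 * d * f + Z ^ 3 * (V / 4)"
      using f real Z V by (subst (asm) ennreal_le_iff) auto
    have split': "V \<le> 9 * d + V / 12 + f"
    proof -
      have "ennreal V \<le> ennreal (9 * d + V / 12 + f)"
        using split f real V by (simp add: ennreal_mult')
      thus ?thesis using f real V by (subst (asm) ennreal_le_iff) auto
    qed
    show ?thesis
    proof (cases "f \<le> V / 2")
      case True
      hence "V / 48 \<le> d" using split' V by simp
      thus ?thesis using real by (simp add: ennreal_leI)
    next
      case False
      have "Z ^ 3 * (V / 4) \<le> Z ^ 3 * (f / 2)" using False Z by (intro mult_left_mono) auto
      hence "Z ^ 3 * (f / 2) \<le> 9 * d * f" using key by (simp add: algebra_simps)
      hence "f * (Z ^ 3 / 2) \<le> f * (9 * d)" by (simp add: algebra_simps)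
      hence "Z ^ 3 / 2 \<le> 9 * d" using False V by (subst (asm) mult_le_cancel_left_pos) auto
      hence "Z ^ 3 / 48 \<le> d" using real(1) by simp
      thus ?thesis using real by (simp add: ennreal_leI)
    qed
  qed simp
qed

text \<open>The length \<open>V powr (1 / 4)\<close> is the one for which \<open>Z ^ 3\<close> and \<open>V / Z\<close> agree, that is, for which the
  elastic energy and the surface energy in the dichotomy balance.\<close>
lemma F3D_lower:
  assumes V: "0 < V"
  shows "ennreal (1 / 48 * min V (V powr (3 / 4))) \<le> F3D V"
  unfolding F3D_def
proof (rule INF_greatest, clarify)
  fix h Dh u Du assume adm: "(h, Dh, u, Du) \<in> admissible V"
  let ?E = "\<integral>\<^sup>+x\<in>Omega h. ennreal ((grad_norm Du x)\<^sup>2) \<partial>lborel"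
  let ?T = "\<integral>\<^sup>+p. ennreal (grad_norm Dh p) \<partial>lborel"
  define Z where "Z = V powr (1 / 4)"
  have Z: "0 < Z" using V by (simp add: Z_def)
  have Z3: "Z ^ 3 = V powr (3 / 4)" using V by (simp add: Z_def powr_power)
  have ZV: "Z * V powr (3 / 4) = V" using V by (simp add: Z_def flip: powr_add)
  show "ennreal (1 / 48 * min V (V powr (3 / 4))) \<le> ?E + ?T"
  proof (cases "ennreal Z * ?T \<le> ennreal (V / 12)")
    case True
    from energy_dichotomy[OF adm V Z this] have "ennreal (1 / 48 * min V (V powr (3 / 4))) \<le> ?E"
    proof
      assume "ennreal (V / 48) \<le> ?E"
      thus ?thesis by (rule order_trans[rotated]) (auto intro!: ennreal_leI)
    next
      assume "ennreal (Z ^ 3 / 48) \<le> ?E"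
      thus ?thesis unfolding Z3 by (rule order_trans[rotated]) (auto intro!: ennreal_leI)
    qed
    thus ?thesis by (rule order_trans) simp
  next
    case False
    have "ennreal (V powr (3 / 4) / 12) \<le> ?T"
    proof (rule ccontr)
      assume "\<not> ennreal (V powr (3 / 4) / 12) \<le> ?T"
      hence "ennreal Z * ?T \<le> ennreal Z * ennreal (V powr (3 / 4) / 12)" by (intro mult_left_mono) auto
      also have "\<dots> = ennreal (V / 12)" using Z ZV by (simp flip: ennreal_mult')
      finally show False using False by simp
    qed
    moreover have "1 / 48 * min V (V powr (3 / 4)) \<le> V powr (3 / 4) / 12"
      using min.cobounded2[of V "V powr (3 / 4)"] powr_ge_zero[of V "3 / 4"] by linarith
    ultimately have "ennreal (1 / 48 * min V (V powr (3 / 4))) \<le> ?T"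
      by (meson ennreal_leI order_trans)
    thus ?thesis by (rule order_trans) simp
  qed
qed

section \<open>The upper bound\<close>

lemma C1_fst:
  fixes b :: "'a::euclidean_space \<times> 'b::euclidean_space"
  shows "(fst :: 'a \<times> 'b \<Rightarrow> 'a) \<in> C1" and "partial b fst x = fst b"
proof -
  have d: "(fst has_derivative fst) (at x)" for x :: "'a \<times> 'b" by (auto intro!: derivative_eq_intros)
  show "partial b fst x = fst b" by (rule partial_eqI[OF d])
  show "(fst :: 'a \<times> 'b \<Rightarrow> 'a) \<in> C1" by (rule C1I[OF d]) auto
qed

lemma C1_snd:
  fixes b :: "'a::euclidean_space \<times> 'b::euclidean_space"
  shows "(snd :: 'a \<times> 'b \<Rightarrow> 'b) \<in> C1" and "partial b snd x = snd b"
proof -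
  have d: "(snd has_derivative snd) (at x)" for x :: "'a \<times> 'b" by (auto intro!: derivative_eq_intros)
  show "partial b snd x = snd b" by (rule partial_eqI[OF d])
  show "(snd :: 'a \<times> 'b \<Rightarrow> 'b) \<in> C1" by (rule C1I[OF d]) auto
qed

lemma C1_inner:
  assumes "f \<in> C1" shows "(\<lambda>x. f x \<bullet> c) \<in> C1" "partial b (\<lambda>x. f x \<bullet> c) x = partial b f x \<bullet> c"
proof -
  have d: "((\<lambda>x. f x \<bullet> c) has_derivative (\<lambda>v. partial v f x \<bullet> c)) (at x)" for x
    by (intro has_derivative_inner_left C1_has_derivative assms)
  show "partial b (\<lambda>x. f x \<bullet> c) x = partial b f x \<bullet> c" by (rule partial_eqI[OF d])
  show "(\<lambda>x. f x \<bullet> c) \<in> C1"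
    by (rule C1I[OF d]) (intro continuous_on_inner continuous_on_const C1_partial_continuous[OF assms])
qed

lemma C1c_BV:
  fixes f :: "'a::euclidean_space \<Rightarrow> real"
  assumes f: "f \<in> C1c" shows "f \<in> BV"
  unfolding BV_def
proof (intro CollectI conjI bdd_aboveI)
  show "integrable lborel f" by (rule C1c_integrable(1)[OF f])
  have f1: "f \<in> C1" using f by (simp add: C1c_iff)
  fix y assume "y \<in> {LINT x|lborel. f x * divergence \<phi> x | \<phi>. \<phi> \<in> C1c \<and> (\<forall>x. norm (\<phi> x) \<le> 1)}"
  then obtain \<phi> :: "'a \<Rightarrow> 'a" where y: "y = (LINT x|lborel. f x * divergence \<phi> x)" 
    and \<phi>: "\<phi> \<in> C1c" and le: "\<And>x. norm (\<phi> x) \<le> 1" by blast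
  have \<phi>1: "\<phi> \<in> C1" "compact (supp \<phi>)" using \<phi> by (auto simp: C1c_iff)
  have \<phi>b: "(\<lambda>x. \<phi> x \<bullet> b) \<in> C1c" for b
    using C1_inner(1)[OF \<phi>1(1), of b] compact_suppI[OF \<phi>1(2), of "\<lambda>x. \<phi> x \<bullet> b"]
    by (simp add: C1c_iff supp_zero)
  have int: "integrable lborel (\<lambda>x. f x * (partial b \<phi> x \<bullet> b))" if "b \<in> Basis" for b
    by (rule integrable_continuous_compact_support[OF _ \<phi>1(2)])
      (intro continuous_on_mult continuous_on_inner continuous_on_const C1_continuous[OF f1]
        C1_partial_continuous[OF \<phi>1(1) that], simp add: partial_zero_outside_supp)
  have term_le: "(LINT x|lborel. f x * (partial b \<phi> x \<bullet> b)) \<le> (LINT x|lborel. norm (partial b f x))" if b: "b \<in> Basis" for b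
  proof -
    have "(LINT x|lborel. f x * (partial b \<phi> x \<bullet> b)) = (LINT x|lborel. partial b (\<lambda>x. \<phi> x \<bullet> b) x *\<^sub>R f x)"
      by (simp add: C1_inner(2)[OF \<phi>1(1)] mult.commute)
    also have "\<dots> = (LINT x|lborel. - (\<phi> x \<bullet> b) *\<^sub>R partial b f x)"
      using C1_integration_by_parts[OF \<phi>b f1 b, of b] by simp
    also have "\<dots> \<le> (LINT x|lborel. norm (partial b f x))"
    proof (rule integral_mono)
      show "integrable lborel (\<lambda>x. - (\<phi> x \<bullet> b) *\<^sub>R partial b f x)"
        using C1c_scaleR_integrable[OF \<phi>b C1c_integrable(2)[OF f b], of b] by simp
      show "integrable lborel (\<lambda>x. norm (partial b f x))" by (intro integrable_norm C1c_integrable(2) f b)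
      fix x
      have "\<bar>\<phi> x \<bullet> b\<bar> \<le> 1" using Basis_le_norm[OF b, of "\<phi> x"] le[of x] by linarith
      hence "\<bar>(\<phi> x \<bullet> b) * partial b f x\<bar> \<le> \<bar>partial b f x\<bar>" unfolding abs_mult by (intro mult_left_le_one_le) auto
      thus "- (\<phi> x \<bullet> b) *\<^sub>R partial b f x \<le> norm (partial b f x)" by (simp add: abs_le_iff)
    qed
    finally show ?thesis .
  qed
  have "y = (\<Sum>b\<in>Basis. LINT x|lborel. f x * (partial b \<phi> x \<bullet> b))"
    unfolding y divergence_def sum_distrib_left by (intro Bochner_Integration.integral_sum int)
  also have "\<dots> \<le> (\<Sum>b\<in>Basis. LINT x|lborel. norm (partial b f x))" by (intro sum_mono term_le)
  finally show "y \<le> (\<Sum>b\<in>Basis. LINT x|lborel. norm (partial b f x))" .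
qed

lemma C1c_W1inf:
  fixes f :: "'a::euclidean_space \<Rightarrow> real"
  assumes f: "f \<in> C1c" shows "W1inf UNIV f (\<lambda>b. partial b f)"
proof -
  have f1: "f \<in> C1" using f by (simp add: C1c_iff)
  obtain B where B: "\<And>x. norm (f x) \<le> B" using C1c_bounded[OF f] by metis
  have "f \<in> Linf UNIV"
    using B borel_measurable_integrable[OF C1c_integrable(1)[OF f]]
    by (auto simp: Linf_def set_borel_measurable_def)
  moreover have "partial b f \<in> Linf UNIV" if b: "b \<in> Basis" for b
  proof -
    obtain B where "\<And>x. norm (partial b f x) \<le> B" using partial_bounded[OF f b] by metis
    thus ?thesis using borel_measurable_integrable[OF C1c_integrable(2)[OF f b]]
      by (auto simp: Linf_def set_borel_measurable_def)
  qed
  ultimately show ?thesis using C1_weak_gradient[OF f1] by (simp add: W1inf_def)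
qed

lemma continuous_L2:
  fixes f :: "'a::euclidean_space \<Rightarrow> 'b::euclidean_space"
  assumes f: "continuous_on UNIV f" and U: "U \<in> sets borel" "U \<subseteq> K" "compact K"
  shows "f \<in> L2 U"
proof -
  have [measurable]: "f \<in> borel_measurable borel" "U \<in> sets borel" 
    using f U by (auto intro: borel_measurable_continuous_onI)
  have "set_integrable lborel K (\<lambda>x. (norm (f x))\<^sup>2)"
    by (intro integrable_continuous_compact continuous_intros f U)
  hence "set_integrable lborel U (\<lambda>x. (norm (f x))\<^sup>2)" by (rule set_integrable_subset) (use U in auto)
  thus ?thesis by (simp add: L2_def set_borel_measurable_def)
qed

lemma graph_in_frontier_Omega:
  assumes h: "continuous_on UNIV h" and pos: "0 < h p"
  shows "(p, h p) \<in> frontier (Omega h)"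
proof -
  have "{p} \<times> {0<..<h p} \<subseteq> Omega h" by (auto simp: Omega_def)
  hence "closure ({p} \<times> {0<..<h p}) \<subseteq> closure (Omega h)" by (rule closure_mono)
  hence "(p, h p) \<in> closure (Omega h)" using pos by (auto simp: closure_Times)
  moreover have "(p, h p) \<notin> Omega h" by (simp add: Omega_def)
  ultimately show ?thesis using Omega_open[OF h] by (simp add: frontier_def interior_open)
qed

text \<open>The fundamental theorem of calculus on each vertical line. Only the value at the bottom survives, because
  \<open>\<phi>\<close> vanishes on the graph of \<open>h\<close> wherever \<open>h\<close> is positive.\<close>
lemma C1_bottom_trace:
  fixes u :: "space3 \<Rightarrow> plane"
  assumes h: "continuous_on UNIV h" "\<And>p. 0 \<le> h p" and u: "u \<in> C1"
  shows "bottom_trace (Omega h) (supp h) u (\<lambda>b. partial b u) (\<lambda>p. u (p, 0))"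
  unfolding bottom_trace_def
proof (intro ballI impI)
  fix \<phi> :: "space3 \<Rightarrow> real"
  assume \<phi>: "\<phi> \<in> C1c" and avoid: "supp \<phi> \<inter> (frontier (Omega h) - supp h \<times> {0}) = {}"
  define k :: space3 where "k = (0, 1)"
  have k: "k \<in> Basis" by (simp add: k_def Basis_prod_def)
  have \<phi>1: "\<phi> \<in> C1" using \<phi> by (simp add: C1c_iff)
  define \<psi> where "\<psi> x = \<phi> x *\<^sub>R u x" for x
  have \<psi>: "\<psi> \<in> C1c" unfolding \<psi>_def[abs_def] by (rule C1c_scaleR[OF \<phi> u])
  have \<psi>1: "\<psi> \<in> C1" using \<psi> by (simp add: C1c_iff)
  have p\<psi>: "partial k \<psi> x = partial k \<phi> x *\<^sub>R u x + \<phi> x *\<^sub>R partial k u x" for x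
    unfolding \<psi>_def[abs_def] by (rule C1_scaleR(2)[OF \<phi>1 u])
  have top: "\<phi> (p, h p) = 0" if "h p \<noteq> 0" for p
  proof -
    have "0 < h p" using that h(2)[of p] by linarith
    hence "(p, h p) \<in> frontier (Omega h) - supp h \<times> {0}"
      using graph_in_frontier_Omega[OF h(1), of p] by simp
    with avoid have "(p, h p) \<notin> supp \<phi>" by (metis disjoint_iff)
    thus ?thesis by (rule supp_zero)
  qed
  \<comment> \<open>Such a point is a limit of points of the graph over which \<open>h\<close> is positive; there \<open>\<phi>\<close> vanishes.\<close>
  have edge: "\<phi> (p, 0) = 0" if "p \<in> supp h" "h p = 0" for p
  proof -
    have "continuous_on UNIV (\<lambda>q. \<phi> (q, h q))"
      by (rule continuous_on_compose2[OF C1_continuous[OF \<phi>1, of UNIV]]) (intro continuous_intros h, simp)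
    hence "\<phi> (p, h p) = 0"
      using continuous_constant_on_closure[of "{q. h q \<noteq> 0}" "\<lambda>q. \<phi> (q, h q)" 0 p] that(1) top
      by (simp add: supp_def continuous_on_subset)
    thus ?thesis using that by simp
  qed
  have column: "(LINT z|lborel. indicator (Omega h) (p, z) *\<^sub>R partial k \<psi> (p, z))
    = - (indicator (supp h) p *\<^sub>R \<psi> (p, 0))" for p
  proof (cases "h p = 0")
    case True
    hence "(p, z) \<notin> Omega h" for z by (auto simp: Omega_def)
    moreover have "indicator (supp h) p *\<^sub>R \<psi> (p, 0) = 0" using edge[of p] True by (simp add: \<psi>_def indicator_def)
    ultimately show ?thesis by simp
  next
    case False
    hence pos: "0 < h p" using h(2)[of p] by linarith
    have d: "((\<lambda>z. \<psi> (p, z)) has_vector_derivative partial k \<psi> (p, z)) (at z within {0..h p})" for z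
    proof -
      have "((\<lambda>z. \<psi> (p, z)) has_derivative (\<lambda>t. partial (0, t) \<psi> (p, z))) (at z within {0..h p})"
        by (rule has_derivative_compose[OF _ C1_has_derivative[OF \<psi>1], where f'="\<lambda>t. (0, t)"])
          (auto intro!: derivative_eq_intros)
      moreover have "partial (0, t) \<psi> y = t *\<^sub>R partial k \<psi> y" for t y
        using linear_scale[OF C1_linear_partial[OF \<psi>1], of t k y] by (simp add: k_def zero_prod_def)
      ultimately show ?thesis unfolding has_vector_derivative_def by simp
    qed
    have "((\<lambda>z. partial k \<psi> (p, z)) has_integral \<psi> (p, h p) - \<psi> (p, 0)) {0..h p}"
      by (rule fundamental_theorem_of_calculus) (auto intro: d h(2))
    hence "integral {0<..<h p} (\<lambda>z. partial k \<psi> (p, z)) = - \<psi> (p, 0)"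
      using top[OF False] unfolding integral_open_interval_real[symmetric]
      by (simp add: integral_unique \<psi>_def)
    moreover have "set_integrable lborel {0<..<h p} (\<lambda>z. partial k \<psi> (p, z))"
    proof (rule set_integrable_subset)
      show "set_integrable lborel {0..h p} (\<lambda>z. partial k \<psi> (p, z))"
        by (intro integrable_continuous_compact)
          (auto intro!: continuous_on_compose2[OF C1_partial_continuous[OF \<psi>1 k, of UNIV]] continuous_intros)
    qed auto
    ultimately have "(LINT z:{0<..<h p}|lborel. partial k \<psi> (p, z)) = - \<psi> (p, 0)"
      by (simp add: set_borel_integral_eq_integral(2))
    moreover have "indicator (Omega h) (p, z) = (indicator {0<..<h p} z :: real)" for z
      by (auto simp: Omega_def indicator_def)
    moreover have "p \<in> supp h" using supp_zero[of p h] False by blast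
    ultimately show ?thesis by (simp add: set_lebesgue_integral_def)
  qed
  have int: "integrable lborel (\<lambda>x. indicator (Omega h) x *\<^sub>R partial k \<psi> x)"
    using Omega_open[OF h(1)] by (intro integrable_mult_indicator C1c_integrable(2)[OF \<psi> k]) auto
  have "(LINT x:Omega h|lborel. partial (0, 1) \<phi> x *\<^sub>R u x + \<phi> x *\<^sub>R partial (0, 1) u x)
    = (LINT x|lborel. indicator (Omega h) x *\<^sub>R partial k \<psi> x)"
    unfolding set_lebesgue_integral_def p\<psi> by (simp add: k_def)
  also have "\<dots> = (LINT p|lborel. LINT z|lborel. indicator (Omega h) (p, z) *\<^sub>R partial k \<psi> (p, z))"
    using lborel_pair.integral_fst'[of "\<lambda>x. indicator (Omega h) x *\<^sub>R partial k \<psi> x"] int unfolding lborel_prod by simp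
  also have "\<dots> = - (LINT p:supp h|lborel. \<phi> (p, 0) *\<^sub>R u (p, 0))"
    unfolding column set_lebesgue_integral_def \<psi>_def by simp
  finally show "(LINT x:Omega h|lborel. partial (0, 1) \<phi> x *\<^sub>R u x + \<phi> x *\<^sub>R partial (0, 1) u x)
    = - (LINT p:supp h|lborel. \<phi> (p, 0) *\<^sub>R u (p, 0))" .
qed

text \<open>The prescribed displacement, relaxed exponentially over the height \<open>R\<close>. On a disc of radius \<open>R\<close> its
  gradient is bounded, and its energy stays below a multiple of \<open>R ^ 3\<close> however tall the domain is.\<close>
definition decaying_stretch :: "real \<Rightarrow> space3 \<Rightarrow> plane" where
  "decaying_stretch R x = exp (- snd x / R) *\<^sub>R fst x"

lemma decaying_stretch_C1:
  assumes R: "0 < R" 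
  shows "decaying_stretch R \<in> C1"
    "partial b (decaying_stretch R) x = (- exp (- snd x / R) / R * snd b) *\<^sub>R fst x + exp (- snd x / R) *\<^sub>R fst b"
proof -
  have e: "decaying_stretch R = (\<lambda>x. exp (- snd x / R) *\<^sub>R fst x)" by (simp add: decaying_stretch_def fun_eq_iff)
  have d: "((\<lambda>s. exp (- s / R)) has_real_derivative - exp (- s / R) / R) (at s)" for s
    using R by (auto intro!: derivative_eq_intros simp: field_simps)
  have c: "continuous_on UNIV (\<lambda>s. - exp (- s / R) / R)" using R by (intro continuous_intros) auto
  note E = C1_compose[OF C1_snd(1) d c]
  show "decaying_stretch R \<in> C1" unfolding e by (rule C1_scaleR(1)[OF E(1) C1_fst(1)])
  show "partial b (decaying_stretch R) x = (- exp (- snd x / R) / R * snd b) *\<^sub>R fst x + exp (- snd x / R) *\<^sub>R fst b"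
    unfolding e C1_scaleR(2)[OF E(1) C1_fst(1)] E(2) C1_fst(2) C1_snd(2) ..
qed

lemma decaying_stretch_gradient:
  assumes R: "0 < R" and x: "norm (fst x) \<le> R"
  shows "(grad_norm (\<lambda>b. partial b (decaying_stretch R)) x)\<^sup>2 \<le> 3 * exp (- 2 * snd x / R)"
proof -
  have "norm (partial b (decaying_stretch R) x) \<le> exp (- snd x / R)" if "b \<in> Basis" for b
  proof -
    from that consider b' where "b = (b', 0)" "b' \<in> Basis" | "b = (0, 1)" by (auto simp: Basis_prod_def)
    thus ?thesis
    proof cases
      case 1 thus ?thesis by (simp add: decaying_stretch_C1(2)[OF R])
    next
      case 2
      have "exp (- snd x / R) * (norm (fst x) / R) \<le> exp (- snd x / R) * 1"
        using R x by (intro mult_left_mono) auto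
      thus ?thesis using R 2 by (simp add: decaying_stretch_C1(2)[OF R])
    qed
  qed
  hence "(norm (partial b (decaying_stretch R) x))\<^sup>2 \<le> (exp (- snd x / R))\<^sup>2" if "b \<in> Basis" for b
    using that by (intro power_mono) auto
  hence "(\<Sum>b\<in>Basis. (norm (partial b (decaying_stretch R) x))\<^sup>2) \<le> of_nat (card (Basis :: space3 set)) * (exp (- snd x / R))\<^sup>2"
    by (rule sum_bounded_above)
  also have "\<dots> = 3 * exp (- 2 * snd x / R)" by (simp add: power2_eq_square flip: exp_add)
  finally show ?thesis unfolding grad_norm_def by (simp add: sum_nonneg)
qed

lemma nn_integral_exp_decay:
  assumes "0 < R"
  shows "(\<integral>\<^sup>+z. ennreal (3 * exp (- 2 * z / R)) * indicator {0..} z \<partial>lborel) = ennreal (3 / 2 * R)"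
proof -
  have "(\<integral>\<^sup>+z. ennreal (3 * exp (- 2 * z / R)) * indicator {0..} z \<partial>lborel) = 0 - (- (3 / 2 * R * exp (- 2 * 0 / R)))"
  proof (rule nn_integral_FTC_atLeast)
    show "((\<lambda>z. - (3 / 2 * R * exp (- 2 * z / R))) has_real_derivative 3 * exp (- 2 * z / R)) (at z)" for z
      using assms by (auto intro!: derivative_eq_intros simp: field_simps)
    have "((\<lambda>z. exp (- (2 / R) * z)) \<longlongrightarrow> 0) at_top"
      using assms by (intro filterlim_compose[OF exp_at_bot] filterlim_tendsto_neg_mult_at_bot[OF tendsto_const _ filterlim_ident]) auto
    hence "((\<lambda>z. - (3 / 2 * R * exp (- (2 / R) * z))) \<longlongrightarrow> - (3 / 2 * R * 0)) at_top" by (intro tendsto_intros)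
    thus "((\<lambda>z. - (3 / 2 * R * exp (- 2 * z / R))) \<longlongrightarrow> 0) at_top" by simp
  qed auto
  thus ?thesis by simp
qed

lemma disc_area: "0 \<le> r \<Longrightarrow> emeasure lborel (ball (0::plane) r) = ennreal (pi * r\<^sup>2)"
  by (simp add: emeasure_ball unit_ball_vol_2 power2_eq_square ennreal_mult)

text \<open>The competitor is a bump of volume \<open>V\<close> over a disc of radius \<open>R\<close>. The integral of the bump of height
  \<open>1\<close> is comparable to \<open>R\<^sup>2\<close>, so its height is comparable to \<open>V / R\<^sup>2\<close>, its slope to \<open>V / R ^ 3\<close>, and its
  surface energy to \<open>V / R\<close>.\<close>
lemma F3D_le_competitor:
  assumes V: "0 < V" and R: "0 < R"
  shows "F3D V \<le> ennreal (min (3 * V) (6 * R ^ 3) + 64 * V / R)"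
proof -
  let ?B = "ball (0::plane) R"
  have [measurable]: "?B \<in> sets borel" by (intro borel_open open_ball)
  define I where "I = (LINT p|lborel. bump (0::plane) R p)"
  have I: "pi * R\<^sup>2 / 8 \<le> I"
  proof -
    have "(LINT p|lborel. 1 / 2 * indicator (ball (0::plane) (R / 2)) p) \<le> I"
      unfolding I_def
    proof (rule integral_mono)
      show "integrable lborel (\<lambda>p. 1 / 2 * indicator (ball (0::plane) (R / 2)) p :: real)"
        using R by (intro integrable_mult_right integrable_real_indicator) (auto simp: disc_area)
      show "integrable lborel (bump (0::plane) R)" by (intro C1c_integrable bump_C1c R)
      show "1 / 2 * indicator (ball 0 (R / 2)) p \<le> bump (0::plane) R p" for p
        using bump_ge_half[OF R, of p 0] bump_nonneg[of 0 R p] by (auto simp: indicator_def)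
    qed
    moreover have "measure lborel (ball (0::plane) (R / 2)) = pi * (R / 2)\<^sup>2"
      using disc_area[of "R / 2"] R by (simp add: measure_def)
    ultimately show ?thesis by (simp add: power2_eq_square)
  qed
  have I0: "0 < I" using I R by (meson divide_pos_pos less_le_trans mult_pos_pos pi_gt_zero zero_less_numeral zero_less_power)
  \<comment> \<open>The height is chosen so that the volume is \<open>V\<close>.\<close>
  define H where "H = V / I"
  have H: "0 < H" using V I0 by (simp add: H_def)
  define h where "h p = H * bump 0 R p" for p :: plane
  let ?Dh = "\<lambda>b. partial b h"
  let ?u = "decaying_stretch R"
  let ?Du = "\<lambda>b. partial b ?u"
  have d: "((\<lambda>s. H * s) has_real_derivative H) (at s)" for s by (auto intro!: derivative_eq_intros)
  have h1: "h \<in> C1" unfolding h_def[abs_def] by (rule C1_compose(1)[OF bump_C1[OF R] d]) simp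
  have ph: "partial b h p = H * partial b (bump 0 R) p" for b p 
    unfolding h_def[abs_def] by (rule C1_compose(2)[OF bump_C1[OF R] d]) simp
  have out: "h p = 0" if "p \<notin> ?B" for p using bump_outside[OF R that] by (simp add: h_def)
  have hc: "h \<in> C1c" 
    using h1 compact_suppI[OF compact_cball[of 0 R], of h] out by (simp add: C1c_iff)
  have h0: "0 \<le> h p" and hH: "h p \<le> H" for p
    using H bump_nonneg[of 0 R p] bump_le_1[of 0 R p] by (auto simp: h_def)
  have hV: "(LINT p|lborel. h p) = V"
    unfolding h_def using I0 by (simp add: I_def[symmetric] H_def)
  have hcont: "continuous_on UNIV h" by (rule C1_continuous[OF h1])
  have O: "Omega h \<in> sets borel" using Omega_open[OF hcont] by simp
  have OK: "Omega h \<subseteq> cball 0 R \<times> {0..H}"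
  proof (rule subsetI)
    fix x assume "x \<in> Omega h"
    hence z: "0 < snd x" "snd x < h (fst x)" by (auto simp: Omega_def)
    hence "fst x \<in> ?B" using out[of "fst x"] by force
    thus "x \<in> cball 0 R \<times> {0..H}" using z hH[of "fst x"] by (auto simp: mem_Times_iff)
  qed
  have K: "compact (cball (0::plane) R \<times> {0..H})" by (intro compact_Times) auto
  have uH1: "H1 (Omega h) ?u ?Du"
    unfolding H1_def
    by (intro conjI ballI continuous_L2[OF _ O OK K] C1_weak_gradient C1_continuous C1_partial_continuous decaying_stretch_C1(1)[OF R])
  have "bottom_trace (Omega h) (supp h) ?u ?Du (\<lambda>p. ?u (p, 0))"
    by (rule C1_bottom_trace[OF hcont h0 decaying_stretch_C1(1)[OF R]])
  hence tr: "bottom_trace (Omega h) (supp h) ?u ?Du (\<lambda>p. p)" by (simp add: decaying_stretch_def)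
  have adm: "(h, ?Dh, ?u, ?Du) \<in> admissible V"
    unfolding admissible_def using C1c_BV[OF hc] C1c_W1inf[OF hc] hcont h0 hV uH1 tr by simp
  have E: "(\<integral>\<^sup>+x\<in>Omega h. ennreal ((grad_norm ?Du x)\<^sup>2) \<partial>lborel) \<le> ennreal (min (3 * V) (6 * R ^ 3))"
  proof -
    have inB: "fst x \<in> ?B" "0 < snd x" if "x \<in> Omega h" for x
      using that out[of "fst x"] by (cases x; force simp: Omega_def)+
    have g: "ennreal ((grad_norm ?Du x)\<^sup>2) * indicator (Omega h) x
        \<le> ennreal (3 * exp (- 2 * snd x / R)) * indicator (Omega h) x" for x
      using inB[of x] decaying_stretch_gradient[OF R, of x]
      by (cases "x \<in> Omega h") (auto intro!: ennreal_leI)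
    have "(\<integral>\<^sup>+x\<in>Omega h. ennreal ((grad_norm ?Du x)\<^sup>2) \<partial>lborel) \<le> (\<integral>\<^sup>+x. 3 * indicator (Omega h) x \<partial>lborel)"
    proof (intro nn_integral_mono order_trans[OF g])
      fix x show "ennreal (3 * exp (- 2 * snd x / R)) * indicator (Omega h) x \<le> 3 * indicator (Omega h) x"
      proof (cases "x \<in> Omega h")
        case True
        have "ennreal (3 * exp (- 2 * snd x / R)) \<le> ennreal 3"
          using inB(2)[OF True] R by (intro ennreal_leI) auto
        thus ?thesis using True by simp
      qed simp
    qed
    also have "\<dots> = 3 * emeasure lborel (Omega h)" using O by (simp add: nn_integral_cmult)
    also have "\<dots> = ennreal (3 * V)"
      using emeasure_Omega[OF hcont h0] nn_integral_eq_integral[OF C1c_integrable(1)[OF hc]] h0 hV V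
      by (simp add: ennreal_mult')
    finally have 1: "(\<integral>\<^sup>+x\<in>Omega h. ennreal ((grad_norm ?Du x)\<^sup>2) \<partial>lborel) \<le> ennreal (3 * V)" .
    have "(\<integral>\<^sup>+x\<in>Omega h. ennreal ((grad_norm ?Du x)\<^sup>2) \<partial>lborel)
      \<le> (\<integral>\<^sup>+x. indicator ?B (fst x) * (ennreal (3 * exp (- 2 * snd x / R)) * indicator {0..} (snd x)) \<partial>lborel)"
    proof (intro nn_integral_mono order_trans[OF g])
      fix x show "ennreal (3 * exp (- 2 * snd x / R)) * indicator (Omega h) x \<le>
        indicator ?B (fst x) * (ennreal (3 * exp (- 2 * snd x / R)) * indicator {0..} (snd x))"
        using inB[of x] by (cases "x \<in> Omega h") auto
    qed
    also have "\<dots> = (\<integral>\<^sup>+p. \<integral>\<^sup>+z. indicator ?B p * (ennreal (3 * exp (- 2 * z / R)) * indicator {0..} z) \<partial>lborel \<partial>lborel)"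
    proof -
      have "(\<lambda>x. indicator ?B (fst x) * (ennreal (3 * exp (- 2 * snd x / R)) * indicator {0..} (snd x)))
        \<in> borel_measurable ((lborel :: plane measure) \<Otimes>\<^sub>M (lborel :: real measure))" by measurable
      from lborel.nn_integral_fst[OF this] show ?thesis unfolding lborel_prod by simp
    qed
    also have "\<dots> = (\<integral>\<^sup>+p. indicator ?B p * ennreal (3 / 2 * R) \<partial>lborel)"
      using nn_integral_exp_decay[OF R] by (simp add: nn_integral_cmult)
    also have "\<dots> = ennreal (pi * R\<^sup>2) * ennreal (3 / 2 * R)"
      using R by (subst nn_integral_multc) (simp_all add: disc_area)
    also have "\<dots> = ennreal (3 / 2 * pi * R ^ 3)"
      using R by (simp add: power3_eq_cube power2_eq_square ac_simps flip: ennreal_mult)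
    also have "\<dots> \<le> ennreal (6 * R ^ 3)"
      using R pi_less_4 by (intro ennreal_leI mult_right_mono) auto
    finally show ?thesis using 1 by (simp add: min_def)
  qed
  have T: "(\<integral>\<^sup>+p. ennreal (grad_norm ?Dh p) \<partial>lborel) \<le> ennreal (64 * V / R)"
  proof -
    have pb: "norm (partial b h p) \<le> 4 * H / R * indicator ?B p" if b: "b \<in> Basis" for b p
    proof (cases "p \<in> ?B")
      case True
      let ?m = "max 0 (1 - (norm p)\<^sup>2 / R\<^sup>2)"
      have m: "0 \<le> ?m" "?m \<le> 1" by auto
      have pR: "\<bar>p \<bullet> b\<bar> \<le> R" using Basis_le_norm[OF b, of p] True by simp
      have "norm (partial b h p) = H * (2 * ?m * (2 * \<bar>p \<bullet> b\<bar> / R\<^sup>2))"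
        using H R m by (simp add: ph partial_bump[OF R] abs_mult)
      also have "\<dots> \<le> H * (2 * 1 * (2 * R / R\<^sup>2))"
        using H R m pR by (intro mult_left_mono mult_mono divide_right_mono) auto
      also have "\<dots> = 4 * H / R" using R by (simp add: power2_eq_square)
      finally show ?thesis using True by simp
    next
      case False
      hence "max 0 (1 - (norm p)\<^sup>2 / R\<^sup>2) = 0"
        using bump_outside[OF R False] by (simp add: bump_def)
      thus ?thesis using False by (simp add: ph partial_bump[OF R])
    qed
    have gp: "grad_norm ?Dh p \<le> 8 * H / R * indicator ?B p" for p
    proof -
      let ?c = "4 * H / R * indicator ?B p :: real"
      have c: "0 \<le> ?c" using H R by simp
      have "(\<Sum>b\<in>Basis. (norm (partial b h p))\<^sup>2) \<le> of_nat (card (Basis :: plane set)) * ?c\<^sup>2"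
        by (rule sum_bounded_above, rule power_mono) (use pb in auto)
      also have "\<dots> \<le> (2 * ?c)\<^sup>2"
      proof -
        have "2 * a\<^sup>2 \<le> (2 * a)\<^sup>2" for a :: real by (simp add: power_mult_distrib)
        from this[of ?c] show ?thesis by simp
      qed
      finally have "grad_norm ?Dh p \<le> sqrt ((2 * ?c)\<^sup>2)" unfolding grad_norm_def by (rule real_sqrt_le_mono)
      thus ?thesis using c by simp
    qed
    have "(\<integral>\<^sup>+p. ennreal (grad_norm ?Dh p) \<partial>lborel) \<le> (\<integral>\<^sup>+p. ennreal (8 * H / R) * indicator ?B p \<partial>lborel)"
    proof (rule nn_integral_mono)
      fix p show "ennreal (grad_norm ?Dh p) \<le> ennreal (8 * H / R) * indicator ?B p"
        using ennreal_leI[OF gp[of p]] by (cases "p \<in> ?B") auto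
    qed
    also have "\<dots> = ennreal (8 * H / R) * ennreal (pi * R\<^sup>2)" using R by (subst nn_integral_cmult_indicator) (simp_all add: disc_area)
    also have "\<dots> = ennreal (8 * H / R * (pi * R\<^sup>2))" using H R by (intro ennreal_mult[symmetric]) auto
    also have "\<dots> \<le> ennreal (64 * V / R)"
    proof (rule ennreal_leI)
      have "8 * H / R * (pi * R\<^sup>2) = 64 * V / R * ((pi * R\<^sup>2 / 8) / I)" using R by (simp add: H_def field_simps)
      also have "\<dots> \<le> 64 * V / R * 1" using R V I I0 by (intro mult_left_mono) auto
      finally show "8 * H / R * (pi * R\<^sup>2) \<le> 64 * V / R" by simp
    qed
    finally show ?thesis .
  qed
  have "F3D V \<le> (\<integral>\<^sup>+x\<in>Omega h. ennreal ((grad_norm ?Du x)\<^sup>2) \<partial>lborel) + (\<integral>\<^sup>+p. ennreal (grad_norm ?Dh p) \<partial>lborel)"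
    unfolding F3D_def by (rule INF_lower2[OF adm]) simp
  also have "\<dots> \<le> ennreal (min (3 * V) (6 * R ^ 3)) + ennreal (64 * V / R)" by (rule add_mono[OF E T])
  also have "\<dots> = ennreal (min (3 * V) (6 * R ^ 3) + 64 * V / R)" using V R by (simp add: ennreal_plus)
  finally show ?thesis .
qed

text \<open>For small volumes a disc of radius \<open>1\<close> suffices; for large ones \<open>R ^ 3\<close> and \<open>V / R\<close> balance at
  \<open>R = V powr (1 / 4)\<close>.\<close>
lemma F3D_upper:
  assumes V: "0 < V"
  shows "F3D V \<le> ennreal (70 * min V (V powr (3 / 4)))"
proof (cases "V \<le> 1")
  case True
  have "V powr 1 \<le> V powr (3 / 4)" using V True by (intro powr_mono') auto
  hence "min V (V powr (3 / 4)) = V" using V by (simp add: min_def)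
  moreover have "min (3 * V) (6 * 1 ^ 3) + 64 * V / 1 \<le> 70 * V" using V by simp
  hence "F3D V \<le> ennreal (70 * V)"
    by (intro order_trans[OF F3D_le_competitor[OF V, of 1]] ennreal_leI) auto
  ultimately show ?thesis by simp
next
  case False
  define R where "R = V powr (1 / 4)"
  have R: "0 < R" using V by (simp add: R_def)
  have R3: "R ^ 3 = V powr (3 / 4)" using V by (simp add: R_def powr_power)
  have VR: "V / R = V powr (3 / 4)" using V powr_diff[of V 1 "1 / 4"] by (simp add: R_def)
  have "V powr (3 / 4) \<le> V powr 1" using False by (intro powr_mono) auto
  hence m: "min V (V powr (3 / 4)) = V powr (3 / 4)" using V by (simp add: min_def)
  have "min (3 * V) (6 * R ^ 3) + 64 * V / R \<le> 6 * R ^ 3 + 64 * (V / R)" by simp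
  also have "\<dots> = 70 * V powr (3 / 4)" unfolding R3 VR by simp
  finally show ?thesis unfolding m by (intro order_trans[OF F3D_le_competitor[OF V R]] ennreal_leI)
qed

theorem theorem5p3:
  "\<exists>c::real. c > 0 \<and> (\<forall>V::real. V > 0 \<longrightarrow>
     ennreal (c * min V (V powr (3/4))) \<le> F3D V \<and>
     F3D V \<le> ennreal (1 / c * min V (V powr (3/4))))"
proof (intro exI[of _ "1 / 70"] conjI allI impI)
  fix V :: real assume V: "0 < V"
  show "ennreal (1 / 70 * min V (V powr (3/4))) \<le> F3D V"
    using V by (intro order_trans[OF ennreal_leI F3D_lower[OF V]] mult_right_mono) auto
  show "F3D V \<le> ennreal (1 / (1 / 70) * min V (V powr (3/4)))"
    using F3D_upper[OF V] by simp
qed simp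

end
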